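(* For every positive integer $n$, \[ \mathrm{sat}_4(n,B_4)= \begin{cases} \binom{n}{4} & \text{if } n\leq 6,\\ n & \text{if } n \in \{7,8\},\\ n-3 & \text{if } n\geq 9. \end{cases} \]
   Context: A $4$-uniform hypergraph $H$ has a vertex set $V(H)$ and a set $E(H)$ of $4$-element subsets of $V(H)$ (hyperedges). The bow tie $B_4$ is the $4$-uniform hypergraph with $7$ vertices and two hyperedges sharing exactly one vertex; a $4$-uniform hypergraph is $B_4$-free iff no two of its hyperedges intersect in exactly one vertex. A $4$-uniform hypergraph $H$ is $B_4$-saturated if it is $B_4$-free and for every $4$-subset $e\subseteq V(H)$ with $e\notin E(H)$ there is a hyperedge $f\in E(H)$ with $|e\cap f|=1$ (so adding $e$ creates a copy of $B_4$). $\mathrm{sat}_4(n,B_4)$ is the minimum number of hyperedges of a $B_4$-saturated $4$-uniform hypergraph on $n$ vertices. *)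

theory Defs
  imports Main
begin

definition uniform4 :: "'a set \<Rightarrow> 'a set set \<Rightarrow> bool" where
  "uniform4 V E \<longleftrightarrow> (\<forall>e\<in>E. e \<subseteq> V \<and> card e = 4)"

definition bowtie_free :: "'a set set \<Rightarrow> bool" where
  "bowtie_free E \<longleftrightarrow> (\<forall>e\<in>E. \<forall>f\<in>E. card (e \<inter> f) \<noteq> 1)"

definition bowtie_saturated :: "'a set \<Rightarrow> 'a set set \<Rightarrow> bool" where
  "bowtie_saturated V E \<longleftrightarrow> uniform4 V E \<and> bowtie_free E \<and>
     (\<forall>e. e \<subseteq> V \<and> card e = 4 \<and> e \<notin> E \<longrightarrow> (\<exists>f\<in>E. card (e \<inter> f) = 1))"

definition sat4_B4 :: "nat \<Rightarrow> nat" where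
  "sat4_B4 n = (LEAST m. \<exists>E. bowtie_saturated {0..<n} E \<and> card E = m)"

end

theory Submission
  imports Defs
begin

text \<open>
  The lower bound \<open>n - 3\<close> rests on pairs of twins, that is, vertices lying in the same edges.
  Saturation forces the union of any two disjoint twin pairs to be an edge, so \<open>m\<close> disjoint twin
  pairs span \<open>m choose 2\<close> edges, and \<open>2m - (m choose 2) \<le> 3\<close>. The other covered vertices are
  compensated one by one. A twinless vertex on an edge containing a twin pair lies on at least
  two such edges, each of which has only two twinless vertices. The remaining vertices are either
  of degree one, each on an edge of its own, or form an induced saturated family without twins.

  In a nonempty saturated family without twins there are edges \<open>H\<close> that separate all points of
  their union \<open>D\<close> with \<open>|D| \<le> |H|\<close>; this is a finite search for the vertices and edges forced by
  the lack of twins and by saturation. All edges meeting \<open>D\<close> have at most one vertex outside \<open>D\<close>,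
  and their union is closed, so it can be split off by induction: such a family has at least as
  many edges as vertices. The same kind of search settles \<open>n = 7\<close> and \<open>n = 8\<close>.

  For \<open>n \<ge> 12\<close> the extremal family consists of two twin pairs \<open>{3, 4}\<close> and \<open>{5, 6}\<close>, their
  union, the unions of \<open>{3, 4}\<close> and \<open>{5, 6}\<close> with the pairs in \<open>{0, 1, 2}\<close> and \<open>{7, 8, 9}\<close>
  respectively, and the sets \<open>{0, 1, 2, s}\<close> for all other vertices \<open>s\<close>.
\<close>

subsection \<open>Certificates for finite case analyses\<close>

fun none_common :: "bool list \<Rightarrow> bool list \<Rightarrow> bool" where
  "none_common (x # xs) (y # ys) =
     (if x then if y then False else none_common xs ys else none_common xs ys)"
| "none_common _ _ = True"

fun one_common :: "bool list \<Rightarrow> bool list \<Rightarrow> bool" where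
  "one_common (x # xs) (y # ys) =
     (if x then if y then none_common xs ys else one_common xs ys else one_common xs ys)"
| "one_common _ _ = False"

text \<open>Enumerates the vectors of length \<open>d\<close> with at most \<open>k\<close> entries
  \<open>True\<close>, putting \<open>True\<close> before \<open>False\<close>. The witnesses of a
  certificate node follow this order.\<close>

fun rows :: "nat \<Rightarrow> nat \<Rightarrow> bool list list" where
  "rows 0 k = [[]]"
| "rows (Suc d) k =
     (case k of 0 \<Rightarrow> [] | Suc k' \<Rightarrow> map ((#) True) (rows d k')) @ map ((#) False) (rows d k)"

fun weight :: "bool list \<Rightarrow> nat" where
  "weight [] = 0"
| "weight (x # xs) = (if x then Suc (weight xs) else weight xs)"

text \<open>Reads \<open>b\<close> as an incidence vector relative to the enumeration
  \<open>xs\<close>; because of \<open>zip\<close>, surplus entries on either side are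
  ignored.\<close>

definition select :: "'a list \<Rightarrow> bool list \<Rightarrow> 'a set" where
  "select xs b = {x. (x, True) \<in> set (zip xs b)}"

lemma select_simps [simp]:
  "select [] b = {}"
  "select xs [] = {}"
  "select (x # xs) (y # b) = (if y then insert x (select xs b) else select xs b)"
  by (auto simp: select_def)

lemma select_subset: "select xs b \<subseteq> set xs"
  by (auto simp: select_def dest: set_zip_leftD)

lemma finite_select [simp]: "finite (select xs b)"
  by (rule finite_subset[OF select_subset]) simp

lemma nth_in_select_iff:
  assumes "distinct xs" "length b = length xs" "i < length xs"
  shows "xs ! i \<in> select xs b \<longleftrightarrow> b ! i"
  using assms by (auto simp: select_def in_set_zip nth_eq_iff_index_eq)

lemma select_conv_nth:
  "length b = length xs \<Longrightarrow> select xs b = {xs ! i | i. i < length xs \<and> b ! i}"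
  by (auto simp: select_def in_set_zip)

lemma select_append:
  "length b = length xs \<Longrightarrow> select (xs @ ys) (b @ c) = select xs b \<union> select ys c"
  by (auto simp: select_def)

lemma select_replicate: "select xs (replicate (length xs) v) = (if v then set xs else {})"
  by (induction xs) auto

lemma select_map: "select xs (map (\<lambda>x. x \<in> h) xs) = h \<inter> set xs"
  by (induction xs) auto

lemma card_select:
  "distinct xs \<Longrightarrow> length b = length xs \<Longrightarrow> card (select xs b) = weight b"
proof (induction xs b rule: list_induct2')
  case (4 x xs y ys)
  then have "x \<notin> select xs ys" using select_subset[of xs ys] by auto
  with 4 show ?case by auto
qed auto

lemma none_common_iff:
  "distinct xs \<Longrightarrow> length a = length xs \<Longrightarrow> length b = length xs \<Longrightarrow>
     none_common a b \<longleftrightarrow> select xs a \<inter> select xs b = {}"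
proof (induction xs arbitrary: a b)
  case (Cons x xs)
  then obtain y a' z b' where "a = y # a'" "b = z # b'"
    by (metis length_Suc_conv list.size(4) add_Suc_right add_0_right)
  then show ?case
    using Cons select_subset[of xs a'] select_subset[of xs b'] by auto
qed auto

lemma one_common_iff:
  "distinct xs \<Longrightarrow> length a = length xs \<Longrightarrow> length b = length xs \<Longrightarrow>
     one_common a b \<longleftrightarrow> card (select xs a \<inter> select xs b) = 1"
proof (induction xs arbitrary: a b)
  case (Cons x xs)
  then obtain y a' z b' where ab: "a = y # a'" "b = z # b'"
    by (metis length_Suc_conv list.size(4) add_Suc_right add_0_right)
  have x: "x \<notin> select xs a'" "x \<notin> select xs b'"
    using Cons.prems(1) select_subset[of xs a'] select_subset[of xs b'] by auto
  then have "card (insert x (select xs a') \<inter> insert x (select xs b')) = 1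
      \<longleftrightarrow> select xs a' \<inter> select xs b' = {}"
    by (simp add: Int_insert_left Int_insert_right)
  with Cons ab x show ?case
    by (auto simp: none_common_iff)
qed auto

lemma rows_complete: "weight b \<le> k \<Longrightarrow> b \<in> set (rows (length b) k)"
proof (induction b arbitrary: k)
  case (Cons x b)
  then show ?case
    by (cases x; cases k) auto
qed auto

text \<open>
  A configuration names \<open>d\<close> vertices and lists some edges among them by their incidence vectors.
  A node of a certificate splits cases for one configuration: either some edge separates
  two given vertices, or a given four-set is an edge or is met exactly once by an edge.
  The ways in which this edge can meet the named vertices are the traces; the new edge also
  names its vertices outside the configuration. For each trace, in the order of \<open>traces\<close>, the witness
  says that the extended configuration is won or where it contains one treated before, counting
  table entries backwards from the current node.
\<close>

type_synonym config = "nat \<times> bool list list"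

datatype branch = Separate nat nat | Saturate "bool list"

datatype witness = Won | Embed nat "nat list"

type_synonym node = "config \<times> branch \<times> witness list"

text \<open>
  In the mode \<open>At_most n\<close> there is no assumption on twins, but only \<open>n\<close> vertices are available.
\<close>

datatype mode = Twin_free | At_most nat

fun fits :: "mode \<Rightarrow> nat \<Rightarrow> bool" where
  "fits Twin_free k = True"
| "fits (At_most n) k = (k \<le> n)"

fun admits :: "branch \<Rightarrow> bool list \<Rightarrow> bool" where
  "admits (Separate i j) b = (b ! i \<noteq> b ! j)"
| "admits (Saturate g) b = (b = g \<or> one_common g b)"

text \<open>A trace sharing just one vertex with a listed edge cannot occur: all vertices of a
  listed edge are named, so its whole intersection with the new edge is visible in the
  trace.\<close>

definition traces :: "mode \<Rightarrow> branch \<Rightarrow> config \<Rightarrow> bool list list" where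
  "traces m br c = filter (\<lambda>b. admits br b \<and> fits m (fst c + (4 - weight b)) \<and>
     list_all (\<lambda>e. \<not> one_common e b) (snd c)) (rows (fst c) 4)"

text \<open>Old vertices keep their numbers, and the \<open>4 - weight b\<close> vertices of the new
  edge outside the configuration get the numbers from \<open>fst c\<close> on. The new edge comes
  first in the list.\<close>

definition extend :: "config \<Rightarrow> bool list \<Rightarrow> config" where
  "extend c b = (fst c + (4 - weight b),
     (b @ replicate (4 - weight b) True) # map (\<lambda>e. e @ replicate (4 - weight b) False) (snd c))"

definition wf_config :: "config \<Rightarrow> bool" where
  "wf_config c \<longleftrightarrow> list_all (\<lambda>e. length e = fst c \<and> weight e = 4) (snd c)"

fun wf_branch :: "mode \<Rightarrow> nat \<Rightarrow> branch \<Rightarrow> bool" where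
  "wf_branch m d (Separate i j) = (m = Twin_free \<and> i < d \<and> j < d \<and> i \<noteq> j)"
| "wf_branch m d (Saturate g) = (length g = d \<and> weight g = 4)"

text \<open>Vertex \<open>i\<close> of \<open>c\<close> is sent to vertex \<open>p ! i\<close> of
  \<open>c'\<close>. Edges are compared by pulling back along \<open>p\<close>: a pull-back of
  weight four loses no vertex of an edge of weight four, so it identifies the two edges.\<close>

definition embeds :: "nat list \<Rightarrow> config \<Rightarrow> config \<Rightarrow> bool" where
  "embeds p c c' \<longleftrightarrow> length p = fst c \<and> distinct p \<and> list_all (\<lambda>i. i < fst c') p \<and>
     list_all (\<lambda>e. list_ex (\<lambda>f. map ((!) f) p = e) (snd c')) (snd c)"

fun wins :: "(config \<Rightarrow> bool) \<Rightarrow> config list \<Rightarrow> config \<Rightarrow> witness \<Rightarrow> bool" where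
  "wins won prev c Won = won c"
| "wins won prev c (Embed j p) = (j < length prev \<and> embeds p (prev ! j) c)"

definition check_node :: "mode \<Rightarrow> (config \<Rightarrow> bool) \<Rightarrow> config list \<Rightarrow> node \<Rightarrow> bool" where
  "check_node m won prev nd = (case nd of (c, br, ws) \<Rightarrow>
     wf_config c \<and> wf_branch m (fst c) br \<and>
     list_all2 (\<lambda>b w. wins won prev (extend c b) w) (traces m br c) ws)"

text \<open>An entry can appeal only to entries before it, which rules out circular arguments.
  Special configurations therefore come first and the root of the search comes last.\<close>

fun check :: "mode \<Rightarrow> (config \<Rightarrow> bool) \<Rightarrow> config list \<Rightarrow> node list \<Rightarrow> bool" where
  "check m won prev [] = True"
| "check m won prev (nd # nds) = (check_node m won prev nd \<and> check m won (fst nd # prev) nds)"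

section \<open>Soundness of the certificates in a saturated family\<close>

locale saturated =
  fixes V :: "'a set" and E :: "'a set set"
  assumes finite_V: "finite V" and sat: "bowtie_saturated V E"
begin

lemma edge_subset: "e \<in> E \<Longrightarrow> e \<subseteq> V"
  and card_edge: "e \<in> E \<Longrightarrow> card e = 4"
  and edge_inter: "e \<in> E \<Longrightarrow> f \<in> E \<Longrightarrow> card (e \<inter> f) \<noteq> 1"
  and hit: "g \<subseteq> V \<Longrightarrow> card g = 4 \<Longrightarrow> g \<notin> E \<Longrightarrow> \<exists>f\<in>E. card (g \<inter> f) = 1"
  using sat by (auto simp: bowtie_saturated_def uniform4_def bowtie_free_def)

lemma finite_edge: "e \<in> E \<Longrightarrow> finite e"
  using edge_subset finite_V finite_subset by blast

lemma finite_E: "finite E"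
  by (rule finite_subset[of _ "Pow V"]) (use edge_subset finite_V in auto)

text \<open>Nothing is said about four-sets that are not listed: they may or may not be edges. This
  is why a realized configuration stays realized when edges are forgotten, as \<open>embeds\<close>
  does.\<close>

definition realizes :: "'a list \<Rightarrow> config \<Rightarrow> bool" where
  "realizes xs c \<longleftrightarrow> distinct xs \<and> set xs \<subseteq> V \<and> length xs = fst c \<and> wf_config c \<and>
     (\<forall>e\<in>set (snd c). select xs e \<in> E)"

text \<open>An edge \<open>h\<close> has at most four named vertices, and naming the others
  completes it. As listed edges consist of named vertices, they meet \<open>h\<close> and its trace
  in the same set, so the absence of bow ties carries over to traces.\<close>

lemma realizes_extend:
  assumes real: "realizes xs c" and h: "h \<in> E"
  defines "b \<equiv> map (\<lambda>x. x \<in> h) xs"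
  shows "b \<in> set (rows (fst c) 4)" and "\<forall>e\<in>set (snd c). \<not> one_common e b"
    and "\<exists>ys. realizes ys (extend c b)"
proof -
  have xs: "distinct xs" "set xs \<subseteq> V" "length xs = fst c" "wf_config c"
    and edges: "\<And>e. e \<in> set (snd c) \<Longrightarrow> select xs e \<in> E \<and> length e = fst c"
    using real by (auto simp: realizes_def wf_config_def list_all_iff)
  have len: "length b = fst c" and sel: "select xs b = h \<inter> set xs"
    using xs by (auto simp: b_def select_map)
  have w: "weight b = card (h \<inter> set xs)"
    using card_select[of xs b] xs sel len by simp
  have "weight b \<le> 4"
    unfolding w using card_edge[OF h] finite_edge[OF h] by (metis card_mono inf_le1)
  then show "b \<in> set (rows (fst c) 4)"
    using rows_complete[of b 4] len by simp
  show "\<forall>e\<in>set (snd c). \<not> one_common e b"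
  proof
    fix e assume e: "e \<in> set (snd c)"
    have "select xs e \<inter> select xs b = select xs e \<inter> h"
      using sel select_subset[of xs e] by auto
    with edge_inter[of "select xs e" h] edges[OF e] h show "\<not> one_common e b"
      by (simp add: one_common_iff[of xs] xs len)
  qed
  have card_new: "card (h - set xs) = 4 - weight b"
    using w card_edge[OF h] finite_edge[OF h] by (simp add: card_Diff_subset_Int)
  obtain ns where ns: "set ns = h - set xs" "distinct ns"
    using finite_distinct_list[of "h - set xs"] finite_edge[OF h] by auto
  have lns: "length ns = 4 - weight b"
    using ns card_new distinct_card by fastforce
  have "select (xs @ ns) (b @ replicate (4 - weight b) True) = h"
    using ns lns[symmetric] sel by (auto simp: select_append len xs select_replicate)
  moreover have "select (xs @ ns) (e @ replicate (4 - weight b) False) = select xs e"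
    if "e \<in> set (snd c)" for e
    using edges[OF that] xs lns[symmetric] by (simp add: select_append select_replicate)
  moreover have "weight (e @ replicate k False) = weight e" for e k
    by (induction e) (auto, induction k, auto)
  moreover have "weight (e @ replicate k True) = weight e + k" for e k
    by (induction e) (auto, induction k, auto)
  ultimately have "realizes (xs @ ns) (extend c b)"
    using ns lns xs edges edge_subset[OF h] h len \<open>weight b \<le> 4\<close>
    by (auto simp: realizes_def extend_def wf_config_def list_all_iff)
  then show "\<exists>ys. realizes ys (extend c b)" ..
qed

text \<open>The pull-back of an edge selects a subset of that edge; both sets have four elements, so
  they coincide and the listed set of \<open>c\<close> is an edge of \<open>E\<close>.\<close>

lemma realizes_embeds:
  assumes real: "realizes xs c'" and emb: "embeds p c c'" and wf: "wf_config c"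
  shows "realizes (map ((!) xs) p) c"
proof -
  have xs: "distinct xs" "set xs \<subseteq> V" "length xs = fst c'"
    and edges: "\<And>f. f \<in> set (snd c') \<Longrightarrow> select xs f \<in> E \<and> length f = fst c'"
    using real by (auto simp: realizes_def wf_config_def list_all_iff)
  have p: "length p = fst c" "distinct p" "\<And>i. i \<in> set p \<Longrightarrow> i < fst c'"
    and e_ex: "\<And>e. e \<in> set (snd c) \<Longrightarrow> \<exists>f\<in>set (snd c'). map ((!) f) p = e"
    using emb by (auto simp: embeds_def list_all_iff list_ex_iff)
  let ?ys = "map ((!) xs) p"
  have dist: "distinct ?ys"
    using p xs by (auto simp: distinct_map inj_on_def nth_eq_iff_index_eq)
  have "select ?ys e \<in> E" if e: "e \<in> set (snd c)" for e
  proof -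
    obtain f where f: "f \<in> set (snd c')" "map ((!) f) p = e"
      using e_ex[OF e] by blast
    have "select ?ys e \<subseteq> select xs f"
    proof
      fix x assume "x \<in> select ?ys e"
      then obtain k where k: "k < length p" "x = xs ! (p ! k)" "f ! (p ! k)"
        using f(2) by (auto simp: select_def in_set_zip)
      then show "x \<in> select xs f"
        using p(3)[of "p ! k"] edges[OF f(1)] xs by (auto simp: select_conv_nth)
    qed
    moreover have "card (select ?ys e) = 4"
      using wf e card_select[OF dist, of e] p(1) by (auto simp: wf_config_def list_all_iff)
    moreover have "card (select xs f) = 4"
      using card_edge edges f by blast
    ultimately have "select ?ys e = select xs f"
      by (simp add: card_subset_eq)
    then show ?thesis
      using edges f by simp
  qed
  then show ?thesis
    using dist p xs wf nth_mem[of _ xs] by (auto simp: realizes_def)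
qed

lemma check_node_sound:
  assumes node: "check_node m won prev (c, br, ws)"
    and prev: "\<And>c' xs. c' \<in> set prev \<Longrightarrow> realizes xs c' \<Longrightarrow> G"
    and wf: "\<And>c'. c' \<in> set prev \<Longrightarrow> wf_config c'"
    and won: "\<And>c' xs. won c' \<Longrightarrow> realizes xs c' \<Longrightarrow> G"
    and fits: "fits m (card V)"
    and twin_free: "\<And>x y. m = Twin_free \<Longrightarrow> x \<in> V \<Longrightarrow> y \<in> V \<Longrightarrow> x \<noteq> y \<Longrightarrow>
      \<exists>e\<in>E. (x \<in> e) \<noteq> (y \<in> e)"
    and real: "realizes xs c"
  shows G
proof -
  have xs: "distinct xs" "set xs \<subseteq> V" "length xs = fst c"
    using real by (auto simp: realizes_def)
  have br: "wf_branch m (fst c) br"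
    and all2: "list_all2 (\<lambda>b w. wins won prev (extend c b) w) (traces m br c) ws"
    using node by (auto simp: check_node_def)
  have win: G if h: "h \<in> E" and adm: "admits br (map (\<lambda>x. x \<in> h) xs)" for h
  proof -
    let ?b = "map (\<lambda>x. x \<in> h) xs"
    obtain ys where ys: "realizes ys (extend c ?b)"
      using realizes_extend(3)[OF real h] by blast
    \<comment> \<open>The extended configuration names distinct vertices of \<open>V\<close>, so in
      the mode \<open>At_most n\<close> no trace of an actual edge is filtered out by
      \<open>fits\<close>.\<close>
    then have "fst (extend c ?b) \<le> card V"
      using card_mono[OF finite_V, of "set ys"] distinct_card[of ys] by (auto simp: realizes_def)
    then have "fits m (fst c + (4 - weight ?b))"
      using fits by (cases m) (auto simp: extend_def)
    then have "?b \<in> set (traces m br c)"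
      using realizes_extend(1,2)[OF real h] adm by (auto simp: traces_def list_all_iff)
    then obtain w where w: "wins won prev (extend c ?b) w"
      using all2 by (metis in_set_conv_nth list_all2_conv_all_nth)
    show G
    proof (cases w)
      case Won
      then show ?thesis using w won ys by auto
    next
      case (Embed j p)
      then show ?thesis
        using w realizes_embeds[OF ys, of p "prev ! j"] prev[of "prev ! j"] wf[of "prev ! j"] by auto
    qed
  qed
  show G
  proof (cases br)
    case (Separate i j)
    then have "m = Twin_free" "i < length xs" "j < length xs" "i \<noteq> j"
      using br xs by auto
    moreover then obtain h where "h \<in> E" "(xs ! i \<in> h) \<noteq> (xs ! j \<in> h)"
      using twin_free[of "xs ! i" "xs ! j"] xs by (metis nth_mem nth_eq_iff_index_eq subsetD)
    ultimately show ?thesis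
      using win Separate by auto
  next
    case (Saturate g)
    then have g: "length g = length xs" "weight g = 4"
      using br xs by auto
    have sub: "select xs g \<subseteq> V" and card: "card (select xs g) = 4"
      using select_subset[of xs g] xs g card_select by fastforce+
    show ?thesis
    \<comment> \<open>If the four-set is itself an edge, its trace is \<open>g\<close>, which is the
      disjunct \<open>b = g\<close> in \<open>admits\<close>. Otherwise saturation yields an edge
      meeting it once.\<close>
    proof (cases "select xs g \<in> E")
      case True
      have "map (\<lambda>x. x \<in> select xs g) xs = g"
        using g xs by (auto intro!: nth_equalityI simp: nth_in_select_iff)
      then show ?thesis
        using win[OF True] Saturate by simp
    next
      case False
      then obtain h where h: "h \<in> E" "card (select xs g \<inter> h) = 1"
        using hit[OF sub card] by blast
      have "select xs g \<inter> select xs (map (\<lambda>x. x \<in> h) xs) = select xs g \<inter> h"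
        using select_subset[of xs g] by (auto simp: select_map)
      then have "one_common g (map (\<lambda>x. x \<in> h) xs)"
        using h g xs by (simp add: one_common_iff[of xs])
      then show ?thesis
        using win[OF h(1)] Saturate by simp
    qed
  qed
qed

text \<open>Induction along the table: once a node is settled, its configuration joins
  \<open>prev\<close> and may be used by the following nodes. The applications take the last entry
  for \<open>nd\<close>.\<close>

lemma check_sound:
  assumes "check m won prev nds"
    and "\<And>c' xs. c' \<in> set prev \<Longrightarrow> realizes xs c' \<Longrightarrow> G"
    and "\<And>c'. c' \<in> set prev \<Longrightarrow> wf_config c'"
    and "\<And>c' xs. won c' \<Longrightarrow> realizes xs c' \<Longrightarrow> G"
    and "fits m (card V)"
    and "\<And>x y. m = Twin_free \<Longrightarrow> x \<in> V \<Longrightarrow> y \<in> V \<Longrightarrow> x \<noteq> y \<Longrightarrow> \<exists>e\<in>E. (x \<in> e) \<noteq> (y \<in> e)"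
    and "nd \<in> set nds" and "realizes xs (fst nd)"
  shows G
  using assms
proof (induction nds arbitrary: prev)
  case (Cons nd' nds)
  obtain c br ws where nd': "nd' = (c, br, ws)"
    by (cases nd')
  have node: "check_node m won prev (c, br, ws)" and rest: "check m won (c # prev) nds"
    using Cons.prems(1) nd' by auto
  have G: G if "realizes ys c" for ys
    by (rule check_node_sound[OF node Cons.prems(2-6) that]) auto
  have wf: "wf_config c"
    using node by (simp add: check_node_def)
  show ?case
  proof (cases "nd = nd'")
    case True
    then show ?thesis using G Cons.prems(8) nd' by simp
  next
    case False
    have "nd \<in> set nds" using False Cons.prems(7) by simp
    show ?thesis
      by (rule Cons.IH[OF rest _ _ Cons.prems(4-6) \<open>nd \<in> set nds\<close> Cons.prems(8)])
        (use G wf Cons.prems(2,3) in auto)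
  qed
qed simp

end

subsection \<open>Separated subfamilies\<close>

definition separates :: "'a set set \<Rightarrow> 'a set \<Rightarrow> bool" where
  "separates H D \<longleftrightarrow> (\<forall>x\<in>D. \<forall>y\<in>D. x \<noteq> y \<longrightarrow> (\<exists>e\<in>H. (x \<in> e) \<noteq> (y \<in> e)))"

lemma separatesD:
  "separates H D \<Longrightarrow> x \<in> D \<Longrightarrow> y \<in> D \<Longrightarrow> x \<noteq> y \<Longrightarrow> \<exists>e\<in>H. (x \<in> e) \<noteq> (y \<in> e)"
  by (auto simp: separates_def)

definition won_card :: "nat \<Rightarrow> config \<Rightarrow> bool" where
  "won_card n c \<longleftrightarrow> distinct (snd c) \<and> n \<le> length (snd c)"

text \<open>In the incidence matrix of the listed edges, distinct columns mean that the edges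
  separate the named vertices, and nonzero columns mean that the edges cover them. Thus the listed
  edges have the named vertices as union and are at least as many.\<close>

definition won_dense :: "config \<Rightarrow> bool" where
  "won_dense c \<longleftrightarrow> distinct (snd c) \<and> 0 < fst c \<and> fst c \<le> length (snd c) \<and>
     distinct (map (\<lambda>i. map (\<lambda>e. e ! i) (snd c)) [0..<fst c]) \<and>
     list_all (\<lambda>i. list_ex (\<lambda>e. e ! i) (snd c)) [0..<fst c]"

context saturated
begin

lemma realizes_card_edges:
  assumes "realizes xs c" "distinct (snd c)"
  shows "card (select xs ` set (snd c)) = length (snd c)"
proof -
  have "inj_on (select xs) (set (snd c))"
  proof (rule inj_onI)
    fix e f assume "e \<in> set (snd c)" "f \<in> set (snd c)" "select xs e = select xs f"
    then show "e = f"
      using assms(1) by (intro nth_equalityI)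
        (auto simp: realizes_def wf_config_def list_all_iff simp flip: nth_in_select_iff)
  qed
  then show ?thesis
    using assms(2) by (simp add: card_image distinct_card)
qed

lemma realizes_won_card:
  assumes "realizes xs c" "won_card n c"
  shows "n \<le> card E"
proof -
  have "select xs ` set (snd c) \<subseteq> E"
    using assms(1) by (auto simp: realizes_def)
  then have "card (select xs ` set (snd c)) \<le> card E"
    by (rule card_mono[OF finite_E])
  then show ?thesis
    using realizes_card_edges[OF assms(1)] assms(2) by (simp add: won_card_def)
qed

lemma realizes_won_dense:
  assumes real: "realizes xs c" and won: "won_dense c"
  shows "\<exists>H\<subseteq>E. \<Union>H \<noteq> {} \<and> separates H (\<Union>H) \<and> card (\<Union>H) \<le> card H"
proof (intro exI conjI)
  let ?H = "select xs ` set (snd c)"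
  have xs: "distinct xs" "length xs = fst c"
    and edges: "\<And>e. e \<in> set (snd c) \<Longrightarrow> select xs e \<in> E \<and> length e = length xs"
    using real by (auto simp: realizes_def wf_config_def list_all_iff)
  show "?H \<subseteq> E" using edges by auto
  have U: "\<Union>?H = set xs"
  proof (rule equalityI[OF _ subsetI])
    show "\<Union>?H \<subseteq> set xs" using select_subset[of xs] by auto
    fix x assume "x \<in> set xs"
    then obtain i where i: "i < length xs" "x = xs ! i"
      by (metis in_set_conv_nth)
    then obtain e where "e \<in> set (snd c)" "e ! i"
      using won xs by (fastforce simp: won_dense_def list_all_iff list_ex_iff)
    then show "x \<in> \<Union>?H"
      using i edges nth_in_select_iff[OF xs(1), of e i] by auto
  qed
  show "\<Union>?H \<noteq> {}" using U won xs by (auto simp: won_dense_def)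
  show "card (\<Union>?H) \<le> card ?H"
    using U won xs realizes_card_edges[OF real] distinct_card[of xs] by (auto simp: won_dense_def)
  show "separates ?H (\<Union>?H)"
    unfolding U separates_def
  proof (intro ballI impI)
    fix x y assume "x \<in> set xs" "y \<in> set xs" "x \<noteq> y"
    then obtain i j where ij: "i < length xs" "j < length xs" "x = xs ! i" "y = xs ! j" "i \<noteq> j"
      by (metis in_set_conv_nth)
    let ?l = "map (\<lambda>i. map (\<lambda>e. e ! i) (snd c)) [0..<fst c]"
    have "distinct ?l" using won by (simp add: won_dense_def)
    then have "?l ! i \<noteq> ?l ! j"
      using ij xs by (subst nth_eq_iff_index_eq) auto
    then have "map (\<lambda>e. e ! i) (snd c) \<noteq> map (\<lambda>e. e ! j) (snd c)"
      using ij xs by simp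
    then obtain e where e: "e \<in> set (snd c)" "e ! i \<noteq> e ! j"
      by auto
    then have "(x \<in> select xs e) \<noteq> (y \<in> select xs e)"
      using ij edges nth_in_select_iff[OF xs(1), of e] by simp
    then show "\<exists>e\<in>?H. (x \<in> e) \<noteq> (y \<in> e)"
      using e(1) by blast
  qed
qed

text \<open>An edge meeting \<open>\<Union>H\<close> in just two vertices would meet exactly once any edge of \<open>H\<close> that
  separates them.\<close>

lemma card_outside_separated:
  assumes H: "H \<subseteq> E" "separates H (\<Union>H)" and h: "h \<in> E" "h \<inter> \<Union>H \<noteq> {}"
  shows "card (h - \<Union>H) \<le> 1"
proof -
  let ?D = "\<Union>H"
  note fin = finite_edge[OF h(1)]
  obtain x e where x: "x \<in> h" "x \<in> e" "e \<in> H" using h(2) by auto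
  have "card (h \<inter> e) \<noteq> 1" using edge_inter h(1) H(1) x(3) by blast
  then obtain y where y: "y \<in> h" "y \<in> e" "y \<noteq> x"
    by (metis Int_iff is_singletonI' is_singleton_altdef x(1,2) empty_iff)
  have "card (h \<inter> ?D) \<noteq> 2"
  proof
    assume "card (h \<inter> ?D) = 2"
    moreover have "{x, y} \<subseteq> h \<inter> ?D" using x y by auto
    ultimately have xy: "h \<inter> ?D = {x, y}"
      using y(3) fin by (metis card_2_iff card_subset_eq finite_Int)
    then obtain f where f: "f \<in> H" "(x \<in> f) \<noteq> (y \<in> f)"
      using separatesD[OF H(2)] y(3) by (metis IntD2 insertI1 insert_commute)
    then have "h \<inter> f = {x} \<or> h \<inter> f = {y}"
      using xy by auto
    then show False
      using edge_inter[OF h(1), of f] f H(1) by auto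
  qed
  moreover have "card {x, y} \<le> card (h \<inter> ?D)"
    using x y fin by (intro card_mono) auto
  ultimately have "3 \<le> card (h \<inter> ?D)"
    using y(3) by simp
  then show ?thesis
    using card_edge[OF h(1)] fin card_Diff_subset_Int[of h ?D] by simp
qed

text \<open>A four-set inside \<open>V'\<close> can be met once only by an edge that meets
  \<open>V'\<close>, and all such edges are kept in \<open>E'\<close>, so saturation is
  inherited.\<close>

lemma saturated_closed:
  assumes "\<And>e. e \<in> E' \<Longrightarrow> e \<in> E \<and> e \<subseteq> V'" and "V' \<subseteq> V"
    and "\<And>e. e \<in> E \<Longrightarrow> e \<inter> V' \<noteq> {} \<Longrightarrow> e \<in> E'"
  shows "saturated V' E'"
proof
  show "finite V'" using assms(2) finite_V finite_subset by blast
  have "\<exists>f\<in>E'. card (g \<inter> f) = 1" if g: "g \<subseteq> V'" "card g = 4" "g \<notin> E'" for g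
  proof -
    have "g \<inter> V' \<noteq> {}" using g by (metis Int_absorb2 card.empty zero_neq_numeral)
    then have "g \<notin> E" using assms(3) g(3) by blast
    then obtain f where f: "f \<in> E" "card (g \<inter> f) = 1"
      using hit[of g] g assms(2) by blast
    then have "f \<inter> V' \<noteq> {}"
      using g(1) by (metis Int_absorb2 Int_assoc Int_commute Int_empty_right card.empty zero_neq_one)
    then show ?thesis using f assms(3) by blast
  qed
  then show "bowtie_saturated V' E'"
    using assms(1) card_edge edge_inter
    by (auto simp: bowtie_saturated_def uniform4_def bowtie_free_def)
qed

end

section \<open>The certificates for families without twins and for seven and eight vertices\<close>

definition row :: "nat \<Rightarrow> nat list \<Rightarrow> bool list" where
  "row d vs = map (\<lambda>i. i \<in> set vs) [0..<d]"

lemma length_row: "length (row d vs) = d"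
  by (simp add: row_def)

definition config :: "nat \<Rightarrow> nat list list \<Rightarrow> config" where
  "config d es = (d, map (row d) es)"

text \<open>The three certificates were found by a randomized computer search.\<close>

definition twin_free_table :: "node list" where
  "twin_free_table = [
    (config 5 [[0, 1, 2, 4], [0, 1, 3, 4], [0, 2, 3, 4], [1, 2, 3, 4]],
      Saturate (row 5 [0, 1, 2, 3]),
      [Won]),
    (config 8 [[3, 4, 5, 6], [3, 4, 5, 7], [0, 3, 6, 7], [2, 4, 6, 7], [1, 5, 6, 7], [2, 5, 6, 7],
       [4, 5, 6, 7]],
      Saturate (row 8 [2, 3, 6, 7]),
      [Won, Won, Won, Won]),
    (config 7 [[2, 3, 4, 5], [2, 3, 4, 6], [0, 2, 5, 6], [1, 3, 5, 6], [1, 4, 5, 6], [3, 4, 5, 6]],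
      Saturate (row 7 [1, 2, 4, 6]),
      [Won, Won, Won, Embed 0 [0, 7, 1, 2, 4, 3, 5, 6]]),
    (config 7 [[0, 1, 4, 6], [2, 3, 4, 6], [0, 2, 5, 6], [1, 3, 5, 6], [2, 4, 5, 6], [3, 4, 5, 6]],
      Saturate (row 7 [0, 3, 5, 6]),
      [Won, Won, Won]),
    (config 7 [[1, 3, 4, 6], [0, 1, 5, 6], [2, 3, 5, 6], [2, 4, 5, 6], [3, 4, 5, 6]],
      Saturate (row 7 [1, 3, 4, 5]),
      [Embed 0 [0, 1, 2, 4, 5, 3, 6], Embed 0 [0, 1, 2, 3, 5, 4, 6],
       Embed 1 [0, 2, 1, 3, 4, 5, 6]]),
    (config 7 [[0, 1, 5, 6], [2, 3, 5, 6], [2, 4, 5, 6], [3, 4, 5, 6]],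
      Separate 6 5,
      [Embed 0 [1, 0, 4, 2, 3, 6, 5], Embed 0 [1, 0, 4, 2, 3, 5, 6],
       Embed 0 [1, 0, 3, 2, 4, 6, 5], Embed 0 [1, 0, 3, 2, 4, 5, 6],
       Embed 0 [1, 0, 2, 3, 4, 6, 5], Embed 0 [1, 0, 2, 3, 4, 5, 6],
       Embed 0 [0, 1, 4, 2, 3, 6, 5], Embed 0 [0, 1, 4, 2, 3, 5, 6],
       Embed 0 [0, 1, 3, 2, 4, 6, 5], Embed 0 [0, 1, 3, 2, 4, 5, 6],
       Embed 0 [0, 1, 2, 3, 4, 6, 5], Embed 0 [0, 1, 2, 3, 4, 5, 6]]),
    (config 5 [[0, 1, 3, 4], [0, 2, 3, 4], [1, 2, 3, 4]],
      Saturate (row 5 [0, 1, 2, 4]),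
      [Embed 5 [0, 1, 2, 3, 4], Embed 0 [5, 6, 0, 1, 2, 3, 4]]),
    (config 7 [[0, 1, 2, 6], [0, 1, 3, 6], [2, 3, 4, 6], [2, 3, 5, 6], [0, 4, 5, 6], [1, 4, 5, 6]],
      Saturate (row 7 [0, 3, 4, 6]),
      [Won, Won]),
    (config 7 [[0, 1, 3, 6], [2, 3, 4, 6], [2, 3, 5, 6], [0, 4, 5, 6], [1, 4, 5, 6]],
      Saturate (row 7 [3, 4, 5, 6]),
      [Embed 0 [0, 1, 2, 3, 4, 5, 6], Embed 1 [4, 5, 2, 3, 6]]),
    (config 7 [[2, 3, 4, 6], [2, 3, 5, 6], [0, 4, 5, 6], [1, 4, 5, 6]],
      Saturate (row 7 [2, 3, 4, 5]),
      [Embed 0 [0, 1, 3, 2, 4, 5, 6], Embed 0 [0, 1, 2, 3, 4, 5, 6], Embed 2 [4, 5, 6, 2, 3]]),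
    (config 8 [[1, 4, 5, 6], [0, 2, 3, 7], [2, 4, 5, 7], [1, 2, 6, 7], [3, 4, 6, 7], [0, 5, 6, 7],
       [3, 5, 6, 7]],
      Saturate (row 8 [1, 3, 5, 7]),
      [Won, Won, Won]),
    (config 8 [[1, 4, 5, 6], [2, 4, 5, 7], [1, 2, 6, 7], [3, 4, 6, 7], [0, 5, 6, 7], [3, 5, 6, 7]],
      Saturate (row 8 [4, 5, 6, 7]),
      [Embed 0 [0, 2, 1, 3, 4, 5, 7, 6], Embed 0 [0, 1, 2, 3, 4, 5, 6, 7],
       Embed 4 [4, 5, 3, 6, 7]]),
    (config 9 [[2, 3, 4, 5], [4, 5, 6, 7], [2, 4, 6, 8], [3, 5, 6, 8], [3, 4, 7, 8], [2, 5, 7, 8],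
       [0, 6, 7, 8], [1, 6, 7, 8]],
      Saturate (row 9 [4, 5, 7, 8]),
      [Won, Won]),
    (config 9 [[2, 3, 4, 6], [3, 5, 6, 7], [4, 5, 6, 8], [3, 4, 7, 8], [0, 5, 7, 8], [1, 5, 7, 8],
       [2, 6, 7, 8]],
      Saturate (row 9 [4, 6, 7, 8]),
      [Embed 0 [0, 1, 2, 4, 3, 6, 5, 7, 8], Embed 3 [0, 1, 4, 6, 7, 5, 8]]),
    (config 9 [[0, 3, 4, 5], [3, 4, 6, 7], [3, 5, 6, 8], [4, 5, 7, 8], [1, 6, 7, 8], [2, 6, 7, 8]],
      Saturate (row 9 [3, 4, 6, 8]),
      [Embed 0 [1, 2, 0, 3, 4, 8, 5, 6, 7], Embed 4 [1, 2, 3, 4, 8, 7, 6]]),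
    (config 9 [[3, 5, 6, 7], [4, 5, 6, 8], [3, 4, 7, 8], [0, 5, 7, 8], [1, 6, 7, 8], [2, 6, 7, 8]],
      Saturate (row 9 [0, 6, 7, 8]),
      [Embed 0 [0, 1, 2, 3, 4, 5, 7, 8, 6], Embed 3 [1, 3, 4, 0, 5, 6, 7, 8]]),
    (config 8 [[2, 3, 5, 6], [2, 4, 5, 7], [3, 4, 6, 7], [0, 5, 6, 7], [1, 5, 6, 7]],
      Saturate (row 8 [1, 2, 6, 7]),
      [Embed 4 [1, 2, 4, 0, 3, 6, 5, 7], Embed 4 [1, 2, 3, 0, 4, 7, 5, 6],
       Embed 4 [0, 3, 4, 1, 2, 5, 6, 7], Embed 1 [8, 0, 1, 2, 3, 4, 5, 6, 7],
       Embed 6 [0, 1, 3, 4, 5, 7, 6], Embed 6 [0, 1, 3, 4, 5, 6, 7],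
       Embed 0 [8, 0, 1, 2, 4, 3, 6, 5, 7], Embed 0 [8, 0, 1, 2, 3, 4, 7, 5, 6]]),
    (config 8 [[0, 2, 4, 6], [1, 3, 5, 7], [1, 2, 6, 7], [0, 3, 6, 7], [3, 4, 6, 7], [2, 5, 6, 7],
       [4, 5, 6, 7]],
      Saturate (row 8 [2, 3, 6, 7]),
      [Won]),
    (config 8 [[0, 3, 4, 6], [1, 2, 5, 7], [1, 3, 6, 7], [2, 4, 6, 7], [3, 5, 6, 7], [4, 5, 6, 7]],
      Saturate (row 8 [3, 4, 5, 7]),
      [Embed 0 [0, 2, 4, 1, 3, 5, 6, 7], Embed 0 [0, 1, 3, 2, 4, 5, 6, 7],
       Embed 11 [3, 4, 6, 5, 7]]),
    (config 8 [[0, 4, 5, 7], [1, 4, 6, 7], [3, 4, 6, 7], [2, 5, 6, 7], [3, 5, 6, 7]],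
      Saturate (row 8 [4, 5, 6, 7]),
      [Embed 0 [0, 1, 2, 4, 5, 3, 7, 6], Embed 12 [4, 5, 3, 6, 7]]),
    (config 9 [[2, 3, 5, 6], [2, 4, 5, 8], [3, 4, 6, 8], [0, 4, 7, 8], [1, 4, 7, 8], [3, 5, 7, 8],
       [2, 6, 7, 8], [5, 6, 7, 8]],
      Saturate (row 9 [4, 5, 6, 7]),
      [Won, Won]),
    (config 9 [[2, 3, 4, 7], [3, 4, 5, 8], [0, 5, 6, 8], [1, 5, 6, 8], [2, 5, 7, 8], [3, 6, 7, 8],
       [4, 6, 7, 8]],
      Saturate (row 9 [2, 4, 6, 8]),
      [Embed 0 [0, 1, 2, 3, 5, 7, 4, 6, 8], Embed 4 [0, 1, 3, 7, 4, 5, 6, 8],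
       Embed 1 [0, 2, 4, 3, 5, 6, 7, 8]]),
    (config 9 [[3, 4, 6, 8], [0, 5, 6, 8], [3, 5, 7, 8], [4, 5, 7, 8], [1, 6, 7, 8], [2, 6, 7, 8]],
      Saturate (row 9 [0, 6, 7, 8]),
      [Embed 0 [1, 2, 0, 3, 4, 6, 7, 5, 8], Embed 12 [3, 4, 0, 6, 7, 5, 8]]),
    (config 9 [[0, 5, 6, 8], [1, 5, 7, 8], [2, 5, 7, 8], [3, 6, 7, 8], [4, 6, 7, 8]],
      Saturate (row 9 [0, 5, 6, 7]),
      [Embed 13 [3, 4, 0, 5, 7, 8, 6], Embed 0 [0, 3, 4, 1, 2, 5, 6, 7, 8],
       Embed 0 [0, 1, 2, 3, 4, 6, 5, 7, 8]]),
    (config 8 [[0, 4, 5, 7], [1, 4, 6, 7], [2, 5, 6, 7], [3, 5, 6, 7]],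
      Saturate (row 8 [0, 1, 5, 6]),
      [Embed 7 [2, 3, 0, 1, 4, 5, 6, 7], Embed 4 [1, 0, 3, 2, 4, 6, 5, 7],
       Embed 4 [0, 1, 3, 2, 4, 5, 6, 7], Embed 4 [1, 0, 2, 3, 4, 6, 5, 7],
       Embed 4 [0, 1, 2, 3, 4, 5, 6, 7], Embed 0 [1, 8, 0, 2, 3, 4, 6, 5, 7],
       Embed 0 [0, 8, 1, 2, 3, 4, 5, 6, 7]]),
    (config 7 [[0, 1, 5, 6], [2, 4, 5, 6], [3, 4, 5, 6]],
      Saturate (row 7 [2, 3, 5, 6]),
      [Embed 15 [2, 3, 0, 1, 4, 6, 5], Embed 15 [2, 3, 0, 1, 4, 5, 6],
       Embed 0 [7, 1, 2, 3, 0, 4, 6, 5], Embed 0 [7, 1, 2, 3, 0, 4, 5, 6],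
       Embed 0 [7, 0, 2, 3, 1, 4, 6, 5], Embed 0 [7, 0, 2, 3, 1, 4, 5, 6],
       Embed 18 [2, 3, 4, 5, 6]]),
    (config 5 [[0, 2, 3, 4], [1, 2, 3, 4]],
      Saturate (row 5 [0, 1, 2, 4]),
      [Embed 19 [0, 1, 3, 2, 4], Embed 0 [5, 6, 0, 1, 4, 2, 3], Embed 0 [5, 6, 0, 1, 2, 3, 4]]),
    (config 7 [[0, 1, 4, 5], [2, 3, 4, 5], [0, 2, 4, 6], [1, 3, 4, 6], [1, 2, 5, 6], [0, 3, 5, 6]],
      Saturate (row 7 [0, 1, 2, 3]),
      [Won, Won, Won, Won, Won]),
    (config 7 [[2, 3, 4, 5], [0, 2, 3, 6], [1, 2, 4, 6], [1, 3, 5, 6], [0, 4, 5, 6]],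
      Saturate (row 7 [0, 1, 2, 5]),
      [Embed 0 [0, 1, 3, 4, 2, 5, 6], Embed 1 [3, 5, 0, 4, 6], Embed 1 [3, 2, 1, 4, 6],
       Embed 1 [3, 1, 2, 4, 6], Embed 1 [3, 0, 4, 5, 6]]),
    (config 7 [[1, 2, 4, 5], [1, 3, 4, 6], [2, 3, 5, 6], [0, 4, 5, 6]],
      Saturate (row 7 [0, 1, 3, 5]),
      [Embed 0 [0, 2, 1, 3, 4, 6, 5], Embed 2 [2, 5, 0, 4, 6], Embed 2 [2, 3, 1, 4, 6],
       Embed 2 [2, 1, 3, 4, 6], Embed 2 [2, 0, 4, 5, 6], Embed 2 [7, 0, 4, 5, 6]]),
    (config 6 [[0, 1, 2, 3], [0, 1, 4, 5], [2, 3, 4, 5]],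
      Separate 1 0,
      [Embed 3 [0, 5, 2, 3, 4], Embed 3 [0, 4, 2, 3, 5], Embed 3 [0, 3, 2, 4, 5],
       Embed 0 [6, 1, 3, 5, 0, 2, 4], Embed 0 [6, 1, 3, 4, 0, 2, 5], Embed 3 [0, 2, 3, 4, 5],
       Embed 0 [6, 1, 2, 5, 0, 3, 4], Embed 0 [6, 1, 2, 4, 0, 3, 5], Embed 3 [1, 5, 2, 3, 4],
       Embed 3 [1, 4, 2, 3, 5], Embed 3 [1, 3, 2, 4, 5], Embed 0 [6, 0, 3, 5, 1, 2, 4],
       Embed 0 [6, 0, 3, 4, 1, 2, 5], Embed 3 [1, 2, 3, 4, 5], Embed 0 [6, 0, 2, 5, 1, 3, 4],
       Embed 0 [6, 0, 2, 4, 1, 3, 5]]),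
    (config 6 [[0, 1, 4, 5], [2, 3, 4, 5]],
      Saturate (row 6 [0, 1, 2, 3]),
      [Embed 0 [0, 1, 2, 3, 4, 5], Embed 4 [6, 1, 0, 4, 5], Embed 4 [6, 0, 1, 4, 5],
       Embed 4 [6, 3, 2, 4, 5], Embed 4 [6, 2, 3, 4, 5]]),
    (config 4 [[0, 1, 2, 3]],
      Separate 2 1,
      [Embed 5 [4, 2, 0, 1, 3], Embed 0 [4, 5, 2, 3, 0, 1], Embed 5 [4, 1, 0, 2, 3],
       Embed 0 [4, 5, 1, 3, 0, 2], Embed 0 [4, 5, 0, 2, 1, 3], Embed 0 [4, 5, 0, 1, 2, 3]])]"

definition seven_table :: "node list" where
  "seven_table = [
    (config 7 [[0, 2, 4, 6], [1, 3, 4, 6], [1, 2, 5, 6], [0, 3, 5, 6], [2, 4, 5, 6], [3, 4, 5, 6]],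
      Saturate (row 7 [2, 3, 4, 5]),
      [Won, Won, Won]),
    (config 7 [[0, 1, 2, 6], [0, 3, 4, 6], [1, 3, 5, 6], [2, 3, 5, 6], [1, 4, 5, 6], [2, 4, 5, 6]],
      Saturate (row 7 [0, 1, 5, 6]),
      [Won, Won, Won]),
    (config 7 [[0, 1, 3, 6], [0, 2, 4, 6], [2, 3, 5, 6], [1, 4, 5, 6], [3, 4, 5, 6]],
      Saturate (row 7 [0, 3, 4, 6]),
      [Embed 1 [1, 2, 0, 5, 3, 4, 6], Embed 0 [0, 1, 3, 2, 4, 5, 6]]),
    (config 7 [[0, 1, 4, 5], [2, 3, 4, 5], [0, 2, 4, 6], [1, 3, 4, 6], [1, 2, 5, 6], [0, 3, 5, 6]],
      Saturate (row 7 [0, 1, 2, 3]),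
      [Won, Won, Won, Won, Won]),
    (config 7 [[2, 3, 4, 5], [0, 2, 3, 6], [1, 2, 4, 6], [1, 3, 5, 6], [0, 4, 5, 6]],
      Saturate (row 7 [2, 3, 4, 6]),
      [Embed 0 [0, 1, 3, 4, 2, 5, 6], Embed 1 [5, 1, 0, 3, 4, 2, 6]]),
    (config 7 [[0, 1, 2, 6], [0, 3, 4, 6], [1, 3, 5, 6], [2, 4, 5, 6]],
      Saturate (row 7 [0, 1, 4, 5]),
      [Embed 0 [2, 3, 0, 1, 4, 5, 6], Embed 2 [5, 1, 4, 3, 2, 0, 6],
       Embed 2 [4, 0, 5, 3, 2, 1, 6], Embed 2 [1, 0, 5, 2, 3, 4, 6],
       Embed 2 [0, 1, 4, 2, 3, 5, 6]]),
    (config 7 [[2, 3, 4, 6], [1, 2, 5, 6], [1, 3, 5, 6], [0, 4, 5, 6], [2, 4, 5, 6], [3, 4, 5, 6]],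
      Saturate (row 7 [2, 3, 5, 6]),
      [Won, Won]),
    (config 7 [[1, 3, 4, 6], [1, 2, 5, 6], [0, 3, 5, 6], [2, 4, 5, 6], [3, 4, 5, 6]],
      Saturate (row 7 [1, 3, 5, 6]),
      [Embed 1 [0, 2, 4, 5, 3, 1, 6], Embed 0 [0, 2, 1, 4, 3, 5, 6]]),
    (config 7 [[1, 3, 4, 5], [1, 3, 4, 6], [2, 3, 5, 6], [0, 4, 5, 6], [2, 4, 5, 6], [3, 4, 5, 6]],
      Saturate (row 7 [1, 4, 5, 6]),
      [Won, Won]),
    (config 7 [[0, 3, 4, 5], [1, 3, 4, 6], [2, 3, 5, 6], [2, 4, 5, 6], [3, 4, 5, 6]],
      Saturate (row 7 [0, 3, 4, 6]),
      [Embed 0 [1, 2, 0, 5, 6, 3, 4], Embed 1 [0, 1, 2, 4, 6, 5, 3],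
       Embed 1 [0, 1, 2, 3, 6, 5, 4]]),
    (config 7 [[0, 3, 4, 6], [1, 3, 5, 6], [2, 4, 5, 6], [3, 4, 5, 6]],
      Saturate (row 7 [0, 3, 4, 5]),
      [Embed 0 [1, 2, 0, 5, 6, 3, 4], Embed 2 [0, 2, 1, 4, 5, 3, 6],
       Embed 2 [0, 1, 2, 3, 5, 4, 6]]),
    (config 7 [[0, 3, 4, 6], [1, 3, 5, 6], [2, 4, 5, 6]],
      Saturate (row 7 [3, 4, 5, 6]),
      [Embed 5 [0, 1, 2, 3, 4, 5, 6], Embed 0 [0, 1, 2, 3, 4, 5, 6]]),
    (config 7 [[0, 1, 4, 5], [0, 2, 4, 5], [1, 2, 4, 5], [0, 3, 4, 5], [1, 3, 4, 5], [2, 3, 4, 5]],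
      Saturate (row 7 [0, 4, 5, 6]),
      [Won, Won, Won, Won]),
    (config 7 [[0, 2, 4, 5], [1, 2, 4, 5], [0, 3, 4, 5], [1, 3, 4, 5], [2, 3, 4, 5]],
      Saturate (row 7 [0, 1, 4, 5]),
      [Embed 0 [0, 1, 2, 3, 4, 5, 6], Embed 1 [6, 0, 1, 2, 3, 5, 4],
       Embed 1 [6, 0, 1, 2, 3, 4, 5]]),
    (config 7 [[0, 1, 4, 5], [0, 2, 4, 5], [1, 3, 4, 5], [2, 3, 4, 5]],
      Saturate (row 7 [0, 3, 4, 5]),
      [Embed 0 [1, 2, 0, 3, 4, 5, 6], Embed 2 [6, 0, 3, 1, 2, 5, 4],
       Embed 2 [6, 0, 3, 1, 2, 4, 5]]),
    (config 7 [[0, 2, 4, 5], [1, 3, 4, 5], [2, 3, 4, 5]],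
      Saturate (row 7 [0, 1, 4, 5]),
      [Embed 0 [0, 1, 2, 3, 4, 5, 6], Embed 3 [6, 0, 1, 2, 3, 5, 4],
       Embed 3 [6, 0, 1, 2, 3, 4, 5]]),
    (config 7 [[0, 1, 4, 5], [2, 3, 4, 5]],
      Saturate (row 7 [0, 2, 4, 5]),
      [Embed 0 [1, 3, 0, 2, 4, 5, 6], Embed 4 [6, 0, 2, 1, 3, 5, 4],
       Embed 4 [6, 0, 2, 1, 3, 4, 5]]),
    (config 7 [[0, 2, 3, 4], [1, 2, 3, 4]],
      Saturate (row 7 [0, 2, 3, 5]),
      [Embed 0 [0, 6, 2, 3, 1, 4, 5], Embed 0 [0, 5, 1, 4, 2, 3, 6],
       Embed 0 [1, 6, 0, 3, 2, 4, 5], Embed 0 [1, 6, 0, 2, 3, 4, 5]]),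
    (config 7 [[0, 1, 2, 3]],
      Saturate (row 7 [0, 1, 2, 4]),
      [Embed 0 [4, 3, 0, 1, 2, 5, 6], Embed 1 [5, 6, 1, 2, 0, 3, 4],
       Embed 1 [5, 6, 0, 2, 1, 3, 4], Embed 1 [5, 6, 0, 1, 2, 3, 4]])]"

definition eight_table :: "node list" where
  "eight_table = [
    (config 8 [[3, 4, 5, 6], [1, 3, 5, 7], [2, 4, 5, 7], [2, 3, 6, 7], [1, 4, 6, 7], [0, 5, 6, 7],
       [4, 5, 6, 7]],
      Saturate (row 8 [3, 5, 6, 7]),
      [Won, Won, Won]),
    (config 8 [[2, 3, 4, 5], [0, 2, 3, 6], [1, 2, 4, 6], [1, 2, 5, 6], [1, 3, 5, 6], [0, 4, 5, 6],
       [3, 4, 5, 6]],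
      Saturate (row 8 [2, 5, 6, 7]),
      [Won, Won]),
    (config 8 [[2, 3, 4, 5], [0, 2, 3, 6], [1, 2, 4, 6], [1, 3, 5, 6], [0, 4, 5, 6], [3, 4, 5, 6]],
      Saturate (row 8 [3, 4, 6, 7]),
      [Embed 0 [1, 0, 2, 4, 3, 5, 6, 7], Embed 0 [0, 1, 2, 3, 4, 5, 6, 7],
       Embed 1 [7, 0, 1, 2, 5, 3, 4, 6]]),
    (config 8 [[1, 3, 5, 6], [3, 4, 5, 7], [2, 3, 6, 7], [1, 4, 6, 7], [0, 5, 6, 7], [2, 5, 6, 7],
       [4, 5, 6, 7]],
      Saturate (row 8 [1, 5, 6, 7]),
      [Won, Won]),
    (config 8 [[2, 3, 5, 6], [3, 4, 5, 7], [2, 4, 6, 7], [3, 4, 6, 7], [0, 5, 6, 7], [1, 5, 6, 7],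
       [4, 5, 6, 7]],
      Saturate (row 8 [2, 4, 5, 7]),
      [Won, Won, Won]),
    (config 8 [[2, 3, 5, 6], [2, 4, 5, 7], [3, 4, 6, 7], [0, 5, 6, 7], [1, 5, 6, 7], [4, 5, 6, 7]],
      Saturate (row 8 [2, 4, 6, 7]),
      [Embed 1 [1, 2, 0, 3, 4, 6, 5, 7], Embed 1 [0, 2, 1, 3, 4, 6, 5, 7],
       Embed 0 [0, 1, 3, 2, 4, 5, 6, 7]]),
    (config 8 [[1, 2, 4, 5], [1, 3, 4, 6], [2, 3, 5, 6], [0, 4, 5, 6], [3, 4, 5, 6]],
      Saturate (row 8 [4, 5, 6, 7]),
      [Embed 3 [0, 2, 1, 3, 4, 6, 5, 7], Embed 3 [0, 1, 2, 3, 5, 6, 4, 7],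
       Embed 0 [7, 0, 1, 2, 3, 4, 5, 6]]),
    (config 8 [[0, 1, 2, 3], [0, 1, 4, 5], [0, 2, 4, 5], [1, 2, 4, 5], [0, 3, 4, 5], [1, 3, 4, 5],
       [2, 3, 4, 5]],
      Saturate (row 8 [0, 1, 2, 4]),
      [Won, Won]),
    (config 8 [[0, 1, 2, 3], [0, 2, 4, 5], [1, 2, 4, 5], [0, 3, 4, 5], [1, 3, 4, 5], [2, 3, 4, 5]],
      Saturate (row 8 [0, 1, 4, 5]),
      [Embed 0 [0, 1, 2, 3, 4, 5, 6, 7], Embed 1 [6, 0, 1, 5, 2, 3, 4, 7],
       Embed 1 [7, 0, 1, 5, 2, 3, 4, 6], Embed 1 [6, 0, 1, 4, 2, 3, 5, 7],
       Embed 1 [7, 0, 1, 4, 2, 3, 5, 6]]),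
    (config 8 [[1, 2, 3, 4], [0, 1, 2, 6], [0, 3, 4, 6], [1, 3, 5, 6], [2, 3, 5, 6], [1, 4, 5, 6],
       [2, 4, 5, 6]],
      Saturate (row 8 [1, 2, 5, 7]),
      [Won, Won, Won]),
    (config 8 [[2, 3, 4, 5], [0, 2, 3, 6], [1, 4, 5, 7], [2, 4, 6, 7], [3, 4, 6, 7], [2, 5, 6, 7],
       [3, 5, 6, 7]],
      Saturate (row 8 [0, 4, 5, 6]),
      [Won, Won, Won]),
    (config 8 [[1, 2, 3, 4], [0, 3, 4, 6], [1, 3, 5, 6], [2, 3, 5, 6], [1, 4, 5, 6], [2, 4, 5, 6]],
      Saturate (row 8 [3, 4, 5, 6]),
      [Embed 1 [0, 1, 2, 3, 4, 5, 6, 7], Embed 0 [7, 0, 1, 2, 3, 4, 5, 6],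
       Embed 2 [1, 2, 3, 4, 5, 6, 0, 7]]),
    (config 8 [[0, 1, 2, 3], [0, 1, 4, 5], [0, 2, 4, 5], [1, 3, 4, 5], [2, 3, 4, 5]],
      Saturate (row 8 [0, 3, 4, 5]),
      [Embed 3 [1, 2, 0, 3, 4, 5, 6, 7], Embed 0 [6, 0, 3, 1, 2, 5, 4, 7],
       Embed 0 [7, 0, 3, 1, 2, 5, 4, 6], Embed 0 [6, 0, 3, 1, 2, 4, 5, 7],
       Embed 0 [7, 0, 3, 1, 2, 4, 5, 6]]),
    (config 8 [[0, 1, 2, 3], [0, 2, 4, 5], [1, 3, 4, 5], [2, 3, 4, 5]],
      Saturate (row 8 [0, 1, 4, 5]),
      [Embed 0 [0, 1, 2, 3, 4, 5, 6, 7], Embed 6 [6, 0, 1, 5, 2, 3, 4, 7],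
       Embed 6 [7, 0, 1, 5, 2, 3, 4, 6], Embed 6 [6, 0, 1, 4, 2, 3, 5, 7],
       Embed 6 [7, 0, 1, 4, 2, 3, 5, 6]]),
    (config 8 [[0, 1, 4, 5], [0, 2, 4, 6], [1, 2, 5, 6], [0, 3, 4, 7], [1, 3, 5, 7], [2, 3, 6, 7],
       [4, 5, 6, 7]],
      Saturate (row 8 [0, 1, 6, 7]),
      [Won, Won, Won]),
    (config 8 [[0, 2, 3, 6], [1, 2, 4, 6], [0, 3, 5, 7], [1, 4, 5, 7], [3, 4, 6, 7], [2, 5, 6, 7]],
      Saturate (row 8 [0, 1, 3, 4]),
      [Embed 0 [0, 1, 2, 5, 3, 4, 6, 7]]),
    (config 8 [[2, 3, 5, 6], [0, 1, 4, 7], [2, 4, 5, 7], [3, 4, 6, 7], [1, 5, 6, 7]],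
      Saturate (row 8 [0, 1, 2, 5]),
      [Embed 0 [0, 3, 2, 1, 6, 4, 5, 7], Embed 2 [3, 5, 6, 2, 4, 7, 0, 1],
       Embed 2 [2, 6, 5, 3, 4, 7, 0, 1], Embed 2 [2, 3, 5, 6, 4, 7, 0, 1]]),
    (config 8 [[2, 3, 4, 5], [0, 1, 6, 7], [2, 3, 6, 7], [4, 5, 6, 7]],
      Saturate (row 8 [0, 2, 4, 6]),
      [Embed 0 [1, 0, 3, 5, 7, 2, 4, 6], Embed 0 [1, 0, 2, 4, 6, 3, 5, 7],
       Embed 0 [0, 1, 3, 4, 6, 2, 5, 7], Embed 0 [0, 1, 2, 5, 6, 3, 4, 7],
       Embed 0 [0, 1, 2, 4, 7, 3, 5, 6], Embed 3 [2, 4, 3, 5, 6, 7, 0, 1]]),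
    (config 8 [[0, 1, 2, 3], [0, 1, 4, 5], [2, 3, 4, 5]],
      Saturate (row 8 [0, 1, 6, 7]),
      [Embed 0 [6, 7, 2, 3, 4, 5, 0, 1], Embed 4 [1, 5, 0, 4, 2, 3, 6, 7],
       Embed 4 [1, 4, 0, 5, 2, 3, 6, 7], Embed 4 [1, 3, 0, 2, 4, 5, 6, 7],
       Embed 4 [1, 2, 0, 3, 4, 5, 6, 7], Embed 4 [0, 5, 1, 4, 2, 3, 6, 7],
       Embed 4 [0, 4, 1, 5, 2, 3, 6, 7], Embed 4 [0, 3, 1, 2, 4, 5, 6, 7],
       Embed 4 [0, 2, 1, 3, 4, 5, 6, 7]]),
    (config 8 [[0, 2, 5, 6], [1, 3, 4, 7], [2, 3, 6, 7], [2, 4, 6, 7], [1, 5, 6, 7], [3, 5, 6, 7],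
       [4, 5, 6, 7]],
      Saturate (row 8 [1, 2, 5, 7]),
      [Won, Won, Won, Won]),
    (config 8 [[0, 1, 5, 6], [2, 3, 4, 7], [1, 4, 6, 7], [2, 5, 6, 7], [3, 5, 6, 7], [4, 5, 6, 7]],
      Saturate (row 8 [0, 4, 5, 7]),
      [Embed 1 [0, 5, 4, 7, 1, 6, 2, 3], Embed 0 [0, 3, 1, 2, 4, 5, 6, 7],
       Embed 0 [0, 2, 1, 3, 4, 5, 6, 7]]),
    (config 8 [[0, 1, 5, 6], [2, 3, 4, 7], [2, 5, 6, 7], [3, 5, 6, 7], [4, 5, 6, 7]],
      Saturate (row 8 [0, 2, 5, 7]),
      [Embed 0 [1, 0, 3, 4, 2, 6, 5, 7], Embed 0 [0, 1, 2, 4, 3, 5, 6, 7],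
       Embed 0 [0, 1, 2, 3, 4, 5, 6, 7], Embed 2 [3, 4, 5, 6, 2, 7, 0, 1]]),
    (config 8 [[2, 4, 6, 7], [3, 4, 6, 7], [0, 5, 6, 7], [1, 5, 6, 7], [2, 5, 6, 7], [3, 5, 6, 7],
       [4, 5, 6, 7]],
      Saturate (row 8 [0, 2, 6, 7]),
      [Won, Won, Won, Won, Won]),
    (config 8 [[2, 4, 5, 7], [3, 4, 6, 7], [0, 5, 6, 7], [1, 5, 6, 7], [2, 5, 6, 7], [3, 5, 6, 7],
       [4, 5, 6, 7]],
      Saturate (row 8 [2, 4, 6, 7]),
      [Won, Won, Won]),
    (config 8 [[3, 4, 6, 7], [0, 5, 6, 7], [1, 5, 6, 7], [2, 5, 6, 7], [3, 5, 6, 7], [4, 5, 6, 7]],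
      Saturate (row 8 [0, 3, 6, 7]),
      [Embed 1 [1, 2, 0, 4, 3, 5, 6, 7], Embed 0 [0, 2, 1, 3, 4, 5, 7, 6],
       Embed 0 [0, 2, 1, 3, 4, 5, 6, 7], Embed 0 [0, 1, 2, 3, 4, 5, 7, 6],
       Embed 0 [0, 1, 2, 3, 4, 5, 6, 7]]),
    (config 8 [[0, 4, 6, 7], [1, 5, 6, 7], [2, 5, 6, 7], [3, 5, 6, 7], [4, 5, 6, 7]],
      Saturate (row 8 [0, 5, 6, 7]),
      [Embed 0 [1, 2, 3, 0, 4, 5, 6, 7]]),
    (config 8 [[0, 1, 6, 7], [2, 5, 6, 7], [3, 5, 6, 7], [4, 5, 6, 7]],
      Saturate (row 8 [0, 5, 6, 7]),
      [Embed 0 [1, 2, 3, 4, 0, 5, 6, 7], Embed 4 [0, 1, 2, 3, 4, 6, 7, 5]]),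
    (config 8 [[0, 1, 2, 6], [0, 3, 4, 6], [1, 3, 5, 6], [2, 3, 5, 6], [0, 4, 5, 6], [1, 4, 5, 6],
       [2, 4, 5, 6]],
      Saturate (row 8 [0, 1, 5, 6]),
      [Won, Won, Won]),
    (config 8 [[0, 2, 3, 6], [1, 2, 4, 6], [1, 3, 5, 6], [0, 4, 5, 6], [2, 4, 5, 6], [3, 4, 5, 6]],
      Saturate (row 8 [2, 3, 4, 5]),
      [Embed 0 [3, 0, 2, 1, 5, 4, 6, 7], Embed 0 [2, 0, 3, 1, 4, 5, 6, 7],
       Embed 9 [2, 3, 4, 5, 0, 6, 1, 7]]),
    (config 8 [[1, 2, 3, 6], [0, 3, 5, 6], [1, 4, 5, 6], [2, 4, 5, 6], [3, 4, 5, 6]],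
      Saturate (row 8 [3, 5, 6, 7]),
      [Embed 0 [2, 0, 1, 3, 4, 5, 6, 7], Embed 0 [1, 0, 2, 3, 4, 5, 6, 7],
       Embed 2 [1, 2, 7, 0, 4, 5, 3, 6]]),
    (config 8 [[0, 1, 3, 6], [0, 2, 4, 6], [1, 3, 4, 6], [1, 2, 5, 6], [2, 3, 5, 6], [0, 4, 5, 6],
       [3, 4, 5, 6]],
      Saturate (row 8 [0, 1, 5, 6]),
      [Won, Won]),
    (config 8 [[0, 1, 2, 6], [0, 1, 3, 6], [2, 3, 4, 6], [2, 3, 5, 6], [0, 4, 5, 6], [1, 4, 5, 6]],
      Saturate (row 8 [0, 2, 4, 6]),
      [Embed 0 [3, 1, 5, 0, 2, 4, 6, 7], Embed 0 [2, 0, 4, 1, 3, 5, 6, 7]]),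
    (config 8 [[0, 1, 3, 6], [2, 3, 4, 6], [2, 3, 5, 6], [0, 4, 5, 6], [1, 4, 5, 6]],
      Saturate (row 8 [3, 4, 5, 6]),
      [Embed 0 [0, 1, 2, 3, 4, 5, 6, 7], Embed 2 [2, 0, 1, 3, 5, 4, 6, 7]]),
    (config 8 [[1, 4, 5, 6], [0, 2, 3, 7], [2, 4, 5, 7], [3, 4, 6, 7], [2, 5, 6, 7], [3, 5, 6, 7]],
      Saturate (row 8 [0, 5, 6, 7]),
      [Embed 3 [4, 0, 2, 3, 5, 6, 7, 1], Embed 14 [2, 5, 3, 4, 6, 7, 0, 1],
       Embed 14 [2, 4, 3, 6, 5, 7, 0, 1]]),
    (config 8 [[1, 4, 5, 6], [0, 2, 3, 7], [2, 4, 5, 7], [3, 4, 6, 7], [3, 5, 6, 7]],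
      Saturate (row 8 [0, 3, 4, 5]),
      [Embed 15 [0, 3, 4, 5, 2, 7, 1, 6], Embed 0 [0, 1, 2, 3, 5, 4, 6, 7],
       Embed 0 [0, 1, 2, 3, 4, 5, 6, 7]]),
    (config 8 [[1, 2, 3, 6], [0, 1, 5, 6], [2, 4, 5, 6], [3, 4, 5, 6]],
      Saturate (row 8 [1, 4, 5, 6]),
      [Embed 16 [0, 5, 2, 3, 1, 6, 4, 7], Embed 2 [0, 1, 4, 5, 2, 3, 6, 7],
       Embed 5 [0, 2, 3, 1, 4, 5, 6, 7], Embed 0 [0, 7, 1, 5, 2, 3, 4, 6]]),
    (config 8 [[0, 1, 5, 6], [2, 4, 5, 6], [3, 4, 5, 6]],
      Saturate (row 8 [4, 5, 6, 7]),
      [Embed 0 [1, 0, 2, 3, 4, 6, 5, 7], Embed 0 [1, 0, 2, 3, 4, 5, 6, 7],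
       Embed 0 [0, 1, 2, 3, 4, 6, 5, 7], Embed 0 [0, 1, 2, 3, 4, 5, 6, 7],
       Embed 9 [0, 1, 7, 2, 3, 4, 5, 6]]),
    (config 8 [[0, 1, 4, 5], [2, 3, 4, 5]],
      Saturate (row 8 [0, 1, 2, 3]),
      [Embed 18 [0, 1, 2, 3, 4, 5, 6, 7], Embed 0 [2, 3, 6, 1, 0, 4, 5, 7],
       Embed 0 [2, 3, 7, 1, 0, 4, 5, 6], Embed 0 [2, 3, 6, 0, 1, 4, 5, 7],
       Embed 0 [2, 3, 7, 0, 1, 4, 5, 6], Embed 0 [0, 1, 6, 3, 2, 4, 5, 7],
       Embed 0 [0, 1, 7, 3, 2, 4, 5, 6], Embed 0 [0, 1, 6, 2, 3, 4, 5, 7],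
       Embed 0 [0, 1, 7, 2, 3, 4, 5, 6]]),
    (config 8 [[0, 2, 3, 4], [1, 2, 3, 4]],
      Saturate (row 8 [0, 2, 3, 5]),
      [Embed 0 [0, 6, 2, 3, 1, 4, 5, 7], Embed 0 [0, 7, 2, 3, 1, 4, 5, 6],
       Embed 0 [0, 5, 1, 4, 2, 3, 6, 7], Embed 0 [1, 6, 0, 3, 2, 4, 5, 7],
       Embed 0 [1, 7, 0, 3, 2, 4, 5, 6], Embed 0 [1, 6, 0, 2, 3, 4, 5, 7],
       Embed 0 [1, 7, 0, 2, 3, 4, 5, 6], Embed 0 [6, 7, 0, 3, 2, 4, 1, 5],
       Embed 0 [6, 7, 0, 2, 3, 4, 1, 5]]),
    (config 8 [[0, 1, 2, 3]],
      Saturate (row 8 [0, 1, 4, 5]),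
      [Embed 1 [4, 5, 2, 3, 0, 1, 6, 7], Embed 0 [6, 1, 0, 2, 3, 4, 5, 7],
       Embed 0 [7, 1, 0, 2, 3, 4, 5, 6], Embed 1 [6, 7, 1, 3, 0, 2, 4, 5],
       Embed 1 [6, 7, 1, 2, 0, 3, 4, 5], Embed 0 [6, 0, 1, 2, 3, 4, 5, 7],
       Embed 0 [7, 0, 1, 2, 3, 4, 5, 6], Embed 1 [6, 7, 0, 3, 1, 2, 4, 5],
       Embed 1 [6, 7, 0, 2, 1, 3, 4, 5], Embed 1 [4, 6, 0, 1, 2, 3, 5, 7],
       Embed 1 [4, 7, 0, 1, 2, 3, 5, 6], Embed 1 [5, 6, 0, 1, 2, 3, 4, 7],
       Embed 1 [5, 7, 0, 1, 2, 3, 4, 6]])]"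

section \<open>Consequences of the certificates, and the edge bound without twins\<close>

lemma check_twin_free: "check Twin_free won_dense [] twin_free_table"
  by code_simp

lemma check_seven: "check (At_most 7) (won_card 7) [] seven_table"
  by code_simp

lemma check_eight: "check (At_most 8) (won_card 8) [] eight_table"
  by code_simp

lemma root_row: "4 \<le> d \<Longrightarrow> row d [0, 1, 2, 3] = replicate 4 True @ replicate (d - 4) False"
  by (intro nth_equalityI) (auto simp: row_def nth_append)

context saturated
begin

text \<open>The common start of the searches: one edge, followed by arbitrary further vertices. For
  seven and eight vertices all of \<open>V\<close> is named at once, so every later trace is a full
  edge; the search without twins starts from the edge alone.\<close>

lemma realizes_root:
  assumes e: "e \<in> E" and d: "4 \<le> d" "d \<le> card V"
  shows "\<exists>xs. realizes xs (config d [[0, 1, 2, 3]])"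
proof -
  obtain ys where ys: "set ys = e" "distinct ys"
    using finite_distinct_list finite_edge[OF e] by blast
  obtain zs where zs: "set zs = V - e" "distinct zs"
    using finite_distinct_list[of "V - e"] finite_V by blast
  have ly: "length ys = 4"
    using ys card_edge[OF e] distinct_card by fastforce
  have lz: "length zs = card V - 4"
    using zs distinct_card[of zs] card_edge[OF e] edge_subset[OF e] finite_edge[OF e]
    by (simp add: card_Diff_subset)
  let ?xs = "ys @ take (d - 4) zs"
  have len: "length (take (d - 4) zs) = d - 4"
    using lz d by simp
  have "select ?xs (row d [0, 1, 2, 3]) = e"
    unfolding root_row[OF d(1)] using ys len select_replicate[of ys True]
      select_replicate[of "take (d - 4) zs" False] by (simp add: select_append ly)
  moreover have "weight (replicate 4 True @ replicate k False) = 4" for k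
    by (simp add: numeral_eq_Suc, induction k) auto
  then have "weight (row d [0, 1, 2, 3]) = 4"
    unfolding root_row[OF d(1)] .
  ultimately have "realizes ?xs (config d [[0, 1, 2, 3]])"
    using ys zs ly len d e edge_subset[OF e] set_take_subset[of "d - 4" zs]
    by (auto simp: realizes_def config_def wf_config_def length_row)
  then show ?thesis ..
qed

lemma edges_nonempty: "4 \<le> card V \<Longrightarrow> E \<noteq> {}"
  using hit obtain_subset_with_card_n[of 4 V] by (metis empty_iff)

text \<open>Separation of \<open>V\<close> justifies the \<open>Separate\<close> nodes of the
  certificate, saturation the \<open>Saturate\<close> nodes, and every branch ends in a
  configuration that is \<open>won_dense\<close>.\<close>

lemma dense_subfamily:
  assumes "E \<noteq> {}" "separates E V"
  shows "\<exists>H\<subseteq>E. \<Union>H \<noteq> {} \<and> separates H (\<Union>H) \<and> card (\<Union>H) \<le> card H"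
proof -
  obtain e where e: "e \<in> E" using assms(1) by blast
  then have "4 \<le> card V"
    using card_mono[OF finite_V edge_subset[OF e]] card_edge[OF e] by simp
  then obtain xs where xs: "realizes xs (config 4 [[0, 1, 2, 3]])"
    using realizes_root[OF e] by blast
  have root: "fst (last twin_free_table) = config 4 [[0, 1, 2, 3]]" "twin_free_table \<noteq> []"
    by (simp_all add: twin_free_table_def)
  show ?thesis
  proof (rule check_sound[OF check_twin_free])
    show "last twin_free_table \<in> set twin_free_table" using root(2) by (rule last_in_set)
    show "realizes xs (fst (last twin_free_table))" using xs root(1) by simp
  qed (use realizes_won_dense separatesD[OF assms(2)] in auto)
qed

text \<open>With all seven vertices named, each branch of the search either reaches seven distinct
  edges or contains a configuration settled earlier.\<close>

lemma card_edges_ge_7: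
  assumes "card V = 7"
  shows "7 \<le> card E"
proof -
  obtain xs where xs: "realizes xs (config 7 [[0, 1, 2, 3]])"
    using realizes_root[of _ 7] edges_nonempty assms by auto
  have root: "fst (last seven_table) = config 7 [[0, 1, 2, 3]]" "seven_table \<noteq> []"
    by (simp_all add: seven_table_def)
  show ?thesis
  proof (rule check_sound[OF check_seven])
    show "last seven_table \<in> set seven_table" using root(2) by (rule last_in_set)
    show "realizes xs (fst (last seven_table))" using xs root(1) by simp
  qed (use realizes_won_card assms in auto)
qed

lemma card_edges_ge_8:
  assumes "card V = 8"
  shows "8 \<le> card E"
proof -
  obtain xs where xs: "realizes xs (config 8 [[0, 1, 2, 3]])"
    using realizes_root[of _ 8] edges_nonempty assms by auto
  have root: "fst (last eight_table) = config 8 [[0, 1, 2, 3]]" "eight_table \<noteq> []"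
    by (simp_all add: eight_table_def)
  show ?thesis
  proof (rule check_sound[OF check_eight])
    show "last eight_table \<in> set eight_table" using root(2) by (rule last_in_set)
    show "realizes xs (fst (last eight_table))" using xs root(1) by simp
  qed (use realizes_won_card assms in auto)
qed

end

text \<open>Let \<open>D\<close> be the union of a dense subfamily \<open>H\<close>, and
  \<open>M\<close> the set of edges meeting \<open>D\<close>. Each edge of \<open>M - H\<close> adds
  at most one vertex to \<open>D\<close>, so the union \<open>Y\<close> of \<open>M\<close> has at
  most \<open>card H + card (M - H) = card M\<close> vertices. The edges outside \<open>M\<close>
  form a smaller family of the same kind on \<open>V - Y\<close>.\<close>

lemma twin_free_bound:
  assumes "saturated V E" "\<Union>E = V" "separates E V"
  shows "card V \<le> card E"
  using assms
proof (induction "card V" arbitrary: V E rule: less_induct)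
  case less
  interpret saturated V E by (fact less.prems)
  show ?case
  proof (cases "E = {}")
    case True
    then show ?thesis using less.prems by simp
  next
    case False
    then obtain H where H: "H \<subseteq> E" "\<Union>H \<noteq> {}" "separates H (\<Union>H)" "card (\<Union>H) \<le> card H"
      using dense_subfamily less.prems by blast
    define D where "D = \<Union>H"
    define M where "M = {h \<in> E. h \<inter> D \<noteq> {}}"
    define Y where "Y = \<Union>M"
    have outside: "card (h - D) \<le> 1" if "h \<in> M" for h
      using card_outside_separated[OF H(1,3)] that by (auto simp: M_def D_def)
    have ne: "e \<noteq> {}" if "e \<in> E" for e
      using card_edge[OF that] by auto
    have HM: "H \<subseteq> M"
      using H(1) ne by (fastforce simp: M_def D_def)
    have ME: "M \<subseteq> E" by (auto simp: M_def)
    have fin: "finite M" "finite H" "finite D" "finite Y"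
      using finite_E finite_edge ME HM H(1) finite_subset[of M E] finite_subset[of H E]
      unfolding D_def Y_def by (auto intro!: finite_Union)
    \<comment> \<open>Edges of \<open>H\<close> lie inside \<open>D\<close>, so only
      \<open>M - H\<close> can contribute vertices outside.\<close>
    have "Y \<subseteq> D \<union> (\<Union>h\<in>M - H. h - D)"
      by (auto simp: Y_def D_def)
    then have "card Y \<le> card (D \<union> (\<Union>h\<in>M - H. h - D))"
      using fin finite_edge ME by (intro card_mono) auto
    also have "\<dots> \<le> card D + card (\<Union>h\<in>M - H. h - D)"
      by (rule card_Un_le)
    also have "card (\<Union>h\<in>M - H. h - D) \<le> (\<Sum>h\<in>M - H. card (h - D))"
      using fin by (intro card_UN_le) auto
    also have "\<dots> \<le> (\<Sum>h\<in>M - H. 1)"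
      by (intro sum_mono outside) auto
    also have "card D + (\<Sum>h\<in>M - H. 1) \<le> card H + card (M - H)"
      using H(4) by (simp add: D_def)
    also have "\<dots> = card M"
      using HM fin by (simp add: card_Diff_subset card_mono)
    finally have Y_le: "card Y \<le> card M" by simp
    \<comment> \<open>An edge avoiding \<open>D\<close> can meet an edge of \<open>M\<close> only in
      its single vertex outside \<open>D\<close>, which would be a bow tie.\<close>
    have closed: "h \<in> M" if h: "h \<in> E" "h \<inter> Y \<noteq> {}" for h
    proof (rule ccontr)
      assume "h \<notin> M"
      then have hD: "h \<inter> D = {}" using h by (auto simp: M_def)
      obtain s k where s: "s \<in> h" "s \<in> k" "k \<in> M" using h(2) by (auto simp: Y_def)
      have "card (h \<inter> k) \<le> card (k - D)"
        using hD s finite_edge ME by (intro card_mono) auto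
      with outside[OF s(3)] have "card (h \<inter> k) \<le> 1" by simp
      moreover have "card (h \<inter> k) \<noteq> 0" using s finite_edge[OF h(1)] by auto
      ultimately show False
        using edge_inter[OF h(1), of k] s(3) ME by auto
    qed
    have "saturated (V - Y) (E - M)"
    proof (rule saturated_closed)
      fix e assume "e \<in> E - M"
      then show "e \<in> E \<and> e \<subseteq> V - Y" using closed edge_subset by blast
    qed (auto simp: Y_def)
    moreover have cover: "\<Union>(E - M) = V - Y"
    proof (rule equalityI; rule subsetI)
      fix x assume "x \<in> \<Union>(E - M)"
      then show "x \<in> V - Y" using closed edge_subset by blast
    next
      fix x assume "x \<in> V - Y"
      then obtain e where "e \<in> E" "x \<in> e" "x \<notin> Y" using less.prems(2) by auto
      then show "x \<in> \<Union>(E - M)" by (auto simp: Y_def)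
    qed
    moreover have "separates (E - M) (V - Y)"
      unfolding separates_def
    proof (intro ballI impI)
      fix x y assume xy: "x \<in> V - Y" "y \<in> V - Y" "x \<noteq> y"
      then obtain e where "e \<in> E" "(x \<in> e) \<noteq> (y \<in> e)"
        using separatesD[OF less.prems(3)] by blast
      \<comment> \<open>The separating edge contains \<open>x\<close> or \<open>y\<close>, which lie
        outside \<open>Y\<close>, so it does not belong to \<open>M\<close>.\<close>
      then show "\<exists>e\<in>E - M. (x \<in> e) \<noteq> (y \<in> e)"
        using xy by (intro bexI[of _ e]) (auto simp: Y_def)
    qed
    moreover have YV: "Y \<subseteq> V" "D \<subseteq> Y"
      using edge_subset ME HM by (auto simp: Y_def D_def)
    moreover have "card (V - Y) < card V"
      using YV H(2) finite_V by (intro psubset_card_mono) (auto simp: D_def)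
    ultimately have "card (V - Y) \<le> card (E - M)"
      by (intro less.hyps) auto
    moreover have "card V = card (V - Y) + card Y"
      using YV fin finite_V by (metis card_Diff_subset card_mono le_add_diff_inverse2)
    moreover have "card E = card (E - M) + card M"
      using ME fin finite_E by (metis card_Diff_subset card_mono le_add_diff_inverse2)
    ultimately show ?thesis using Y_le by linarith
  qed
qed

subsection \<open>Twins\<close>

context saturated
begin

text \<open>Two vertices that lie in no edge at all are twins as well.\<close>

definition twin :: "'a \<Rightarrow> 'a \<Rightarrow> bool" where
  "twin x y \<longleftrightarrow> x \<in> V \<and> y \<in> V \<and> x \<noteq> y \<and> (\<forall>e\<in>E. x \<in> e \<longleftrightarrow> y \<in> e)"

lemma twin_sym: "twin x y \<Longrightarrow> twin y x"
  unfolding twin_def by blast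

lemma twin_trans: "twin x y \<Longrightarrow> twin y z \<Longrightarrow> x \<noteq> z \<Longrightarrow> twin x z"
  unfolding twin_def by blast

lemma twinD: "twin x y \<Longrightarrow> x \<in> V" "twin x y \<Longrightarrow> y \<in> V" "twin x y \<Longrightarrow> x \<noteq> y"
  unfolding twin_def by blast+

lemma twin_iff: "twin x y \<Longrightarrow> e \<in> E \<Longrightarrow> x \<in> e \<longleftrightarrow> y \<in> e"
  unfolding twin_def by blast

lemma not_edge_hit:
  assumes "{a, b, c, d} \<notin> E" "card {a, b, c, d} = 4" "{a, b, c, d} \<subseteq> V"
  shows "\<exists>f\<in>E. \<exists>x\<in>{a, b, c, d}. {a, b, c, d} \<inter> f = {x}"
proof -
  obtain f where "f \<in> E" "card ({a, b, c, d} \<inter> f) = 1"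
    using hit assms by blast
  then show ?thesis
    by (metis card_1_singletonE IntD1 insertI1)
qed

text \<open>Every edge contains both or neither vertex of a twin pair, so it meets the union of two
  disjoint pairs in an even number of vertices, never in exactly one.\<close>

lemma twin_pairs_edge:
  assumes t: "twin p p'" "twin q q'" and disj: "{p, p'} \<inter> {q, q'} = {}"
  shows "{p, p', q, q'} \<in> E"
proof (rule ccontr)
  assume "{p, p', q, q'} \<notin> E"
  moreover have ne: "p \<noteq> p'" "q \<noteq> q'" "p \<noteq> q" "p \<noteq> q'" "p' \<noteq> q" "p' \<noteq> q'"
    using twinD(3)[OF t(1)] twinD(3)[OF t(2)] disj by auto
  moreover have "{p, p', q, q'} \<subseteq> V"
    using twinD(1,2)[OF t(1)] twinD(1,2)[OF t(2)] by simp
  ultimately obtain f x where f: "f \<in> E" "{p, p', q, q'} \<inter> f = {x}"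
    using not_edge_hit[of p p' q q'] by auto
  then show False
    using twin_iff[OF t(1) f(1)] twin_iff[OF t(2) f(1)] ne
    by (cases "p \<in> f"; cases "q \<in> f") (auto simp: Int_insert_left)
qed

text \<open>An edge \<open>f\<close> without \<open>p\<close> also misses \<open>p'\<close>, so it
  meets the given edge only within \<open>{x, y}\<close>, and not in a single vertex.\<close>

lemma edge_pair_agree:
  assumes "twin p p'" "{p, p', x, y} \<in> E" "f \<in> E" "p \<notin> f"
  shows "x \<in> f \<longleftrightarrow> y \<in> f"
proof (rule ccontr)
  assume "\<not> ?thesis"
  moreover have "p' \<notin> f" using assms twin_iff by simp
  ultimately have "card ({p, p', x, y} \<inter> f) = 1"
    using assms(4) by (cases "x \<in> f"; cases "y \<in> f") (simp_all add: Int_insert_left)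
  then show False using edge_inter assms(2,3) by blast
qed

text \<open>For a fixed twin pair, the edges \<open>{p, p', x, y}\<close> form a graph on the other
  vertices; this is transitivity of its adjacency, so its components are cliques. An edge meeting
  \<open>{p, p', y, z}\<close> once would miss the pair and separate \<open>y\<close> from
  \<open>z\<close>, although both agree with \<open>x\<close> on it.\<close>

lemma twin_edge_trans:
  assumes t: "twin p p'" and e: "{p, p', x, y} \<in> E" "{p, p', x, z} \<in> E" and ne: "y \<noteq> z"
  shows "{p, p', y, z} \<in> E"
proof (rule ccontr)
  assume ne': "{p, p', y, z} \<notin> E"
  have c: "card {p, p', x, y} = 4" "card {p, p', x, z} = 4"
    using card_edge e by auto
  have d: "p \<noteq> p'" "x \<noteq> y" "x \<noteq> z" "p \<noteq> y" "p' \<noteq> y" "p \<noteq> z" "p' \<noteq> z" "p \<noteq> x" "p' \<noteq> x"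
    using c by (auto simp: card_insert_if split: if_splits)
  have "card {p, p', y, z} = 4" "{p, p', y, z} \<subseteq> V"
    using d ne edge_subset[OF e(1)] edge_subset[OF e(2)] by auto
  then obtain f v where f: "f \<in> E" "{p, p', y, z} \<inter> f = {v}"
    using not_edge_hit[OF ne'] by blast
  have p: "p \<notin> f"
  proof
    assume "p \<in> f"
    then have "{p, p'} \<subseteq> {v}" using f(2) twin_iff[OF t f(1)] by blast
    then show False using d(1) by auto
  qed
  have "p' \<notin> f" using p twin_iff[OF t f(1)] by simp
  then have "{y, z} \<inter> f = {v}"
    using f(2) p by (simp add: Int_insert_left)
  then have "(y \<in> f) \<noteq> (z \<in> f)"
    using ne by (cases "y \<in> f"; cases "z \<in> f") (simp_all add: Int_insert_left doubleton_eq_iff)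
  then show False
    using edge_pair_agree[OF t e(1) f(1) p] edge_pair_agree[OF t e(2) f(1) p] by simp
qed

lemma edge_with_pairE:
  assumes "e \<in> E" "p \<in> e" "p' \<in> e" "w \<in> e" "card {p, p', w} = 3"
  obtains x where "e = {p, p', w, x}" "x \<noteq> p" "x \<noteq> p'" "x \<noteq> w"
proof -
  have "card (e - {p, p', w}) = 1"
    using assms card_edge[of e] finite_edge[of e] by (subst card_Diff_subset) auto
  then obtain x where "e - {p, p', w} = {x}"
    by (auto simp: card_1_singleton_iff)
  then show ?thesis using that[of x] assms by blast
qed

section \<open>Edges containing a twin pair together with twinless vertices\<close>

definition twins :: "'a set" where
  "twins = {x. \<exists>y. twin x y}"

lemma twin_in_twins: "twin x y \<Longrightarrow> x \<in> twins" "twin x y \<Longrightarrow> y \<in> twins"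
  unfolding twins_def using twin_sym by blast+

text \<open>The fourth vertex \<open>w\<close> of an edge containing three mutual twins turns out to
  be a twin of them too.\<close>

lemma twin_triple_edge:
  assumes t: "twin p q" "twin p y" "q \<noteq> y" and e: "e \<in> E" "p \<in> e"
  shows "e \<subseteq> twins"
proof -
  have pq: "q \<in> e" "y \<in> e" "p \<noteq> q" "p \<noteq> y"
    using twin_iff[OF t(1) e(1)] twin_iff[OF t(2) e(1)] e t twinD(3) by auto
  then obtain w where w: "e = {p, q, y, w}" "w \<noteq> p" "w \<noteq> q" "w \<noteq> y"
    using edge_with_pairE[OF e(1), of p q y] e t by auto
  \<comment> \<open>An edge through \<open>w\<close> that misses \<open>p\<close> misses all three
    twins and would meet \<open>e\<close> in \<open>w\<close> alone.\<close>
  have up: "p \<in> f" if f: "f \<in> E" "w \<in> f" for f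
  proof (rule ccontr)
    assume "p \<notin> f"
    then have "e \<inter> f = {w}"
      using w f twin_iff[OF t(1) f(1)] twin_iff[OF t(2) f(1)] by auto
    then show False using edge_inter[OF e(1) f(1)] by simp
  qed
  \<comment> \<open>An edge \<open>{p, q, y, v}\<close> without \<open>w\<close> would give the edge
    \<open>{p, q, w, v}\<close> by transitivity, which contains \<open>p\<close> but not its twin
    \<open>y\<close>.\<close>
  have "w \<in> f" if f: "f \<in> E" "p \<in> f" for f
  proof (rule ccontr)
    assume wf: "w \<notin> f"
    have "q \<in> f" "y \<in> f"
      using twin_iff[OF t(1) f(1)] twin_iff[OF t(2) f(1)] f by auto
    then obtain v where v: "f = {p, q, y, v}" "v \<noteq> p" "v \<noteq> q" "v \<noteq> y"
      using edge_with_pairE[OF f(1), of p q y] f t pq by auto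
    have "{p, q, y, w} \<in> E" "{p, q, y, v} \<in> E" using e f w v by auto
    then have "{p, q, w, v} \<in> E"
      using twin_edge_trans[OF t(1), of y w v] wf v by auto
    then show False
      using twin_iff[OF t(2), of "{p, q, w, v}"] t pq w v by auto
  qed
  then have "\<forall>f\<in>E. p \<in> f \<longleftrightarrow> w \<in> f" using up by blast
  moreover have "p \<in> V" "w \<in> V" using w edge_subset[OF e(1)] by auto
  ultimately have "twin p w" using w(2) unfolding twin_def by blast
  then show ?thesis
    using t w twin_in_twins by auto
qed

text \<open>Together with \<open>plain\<close> and \<open>paired\<close> below, this partitions the
  edges according to whether some, none or all of their vertices have twins.\<close>

definition mixed :: "'a set set" where
  "mixed = {e \<in> E. e \<inter> twins \<noteq> {} \<and> \<not> e \<subseteq> twins}"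

lemma mixedI: "e \<in> E \<Longrightarrow> p \<in> e \<Longrightarrow> p \<in> twins \<Longrightarrow> w \<in> e \<Longrightarrow> w \<notin> twins \<Longrightarrow> e \<in> mixed"
  by (auto simp: mixed_def)

text \<open>If the fourth vertex \<open>x\<close> had a twin, that twin would lie on
  \<open>e\<close> and differ from \<open>w\<close>, hence be \<open>p\<close> or \<open>p'\<close>.
  Then \<open>p\<close>, \<open>p'\<close> and \<open>x\<close> would be three mutual twins, and
  \<open>twin_triple_edge\<close> would put all of \<open>e\<close> into
  \<open>twins\<close>.\<close>

lemma mixedE:
  assumes e: "e \<in> mixed" and w: "w \<in> e" "w \<notin> twins"
  obtains p p' x where "twin p p'" "e = {p, p', w, x}" "x \<notin> twins" "x \<noteq> w"
proof -
  have eE: "e \<in> E" and nsub: "\<not> e \<subseteq> twins" using e by (auto simp: mixed_def)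
  obtain p p' where t: "twin p p'" "p \<in> e"
    using e by (auto simp: mixed_def twins_def)
  have p': "p' \<in> e" "p \<noteq> p'" "p \<noteq> w" "p' \<noteq> w"
    using t twin_iff[OF t(1) eE] w twin_sym twinD(3) by (auto simp: twins_def)
  then obtain x where x: "e = {p, p', w, x}" "x \<noteq> p" "x \<noteq> p'" "x \<noteq> w"
    using edge_with_pairE[OF eE, of p p' w] t w by auto
  have "x \<notin> twins"
  proof
    assume "x \<in> twins"
    then obtain y where y: "twin x y" by (auto simp: twins_def)
    then have "y \<in> e" "y \<noteq> x" using twin_iff[OF y eE] x twinD(3)[OF y] by auto
    moreover have "y \<noteq> w" using y w twin_sym by (auto simp: twins_def)
    ultimately have "y = p \<or> y = p'" using x by auto
    then have "twin p x" using y t x twin_sym twin_trans by metis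
    then show False using twin_triple_edge[OF t(1), of x e] x eE t nsub by auto
  qed
  then show ?thesis using that t x by blast
qed

text \<open>Since \<open>w\<close> and \<open>x\<close> are not twins, some edge \<open>f\<close>
  separates them, and by \<open>edge_pair_agree\<close> it contains \<open>p\<close> and
  \<open>p'\<close>. It yields a second neighbour \<open>y\<close> of \<open>w\<close> over this
  pair, directly if \<open>w\<close> is in \<open>f\<close> and by transitivity if \<open>x\<close>
  is.\<close>

lemma mixed_vertex:
  assumes e: "e \<in> mixed" and w: "w \<in> e" "w \<notin> twins"
  obtains p p' x y where "twin p p'" "{p, p', w, x} \<in> mixed" "{p, p', w, y} \<in> mixed"
    "x \<notin> twins" "y \<notin> twins" "x \<noteq> y" "x \<noteq> w" "y \<noteq> w"
proof -
  obtain p p' x where t: "twin p p'" and e_eq: "e = {p, p', w, x}" and x: "x \<notin> twins" "x \<noteq> w"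
    by (rule mixedE[OF e w])
  have eE: "{p, p', w, x} \<in> E" using e unfolding e_eq mixed_def by simp
  have pt: "p \<in> twins" "p' \<in> twins" using twin_in_twins[OF t] by simp_all
  have pd: "p \<noteq> p'" "p \<noteq> w" "p' \<noteq> w" "p \<noteq> x" "p' \<noteq> x" using twinD(3)[OF t] w x pt by auto
  have "w \<in> V" "x \<in> V" using edge_subset[OF eE] by auto
  then have "\<not> twin w x" using w by (auto simp: twins_def)
  then obtain f where f: "f \<in> E" "(w \<in> f) \<noteq> (x \<in> f)"
    using \<open>w \<in> V\<close> \<open>x \<in> V\<close> x by (auto simp: twin_def)
  have pf: "p \<in> f" "p' \<in> f"
    using edge_pair_agree[OF t eE f(1)] f(2) twin_iff[OF t f(1)] by auto
  have "\<exists>y. {p, p', w, y} \<in> E \<and> y \<noteq> x"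
  proof (cases "w \<in> f")
    case True
    then obtain y where "f = {p, p', w, y}"
      using edge_with_pairE[OF f(1) pf True] pd by auto
    then show ?thesis using f True by auto
  next
    case False
    then have "x \<in> f" using f by simp
    then obtain y where y: "f = {p, p', x, y}" "y \<noteq> x"
      using edge_with_pairE[OF f(1) pf, of x] pd by auto
    then have "{p, p', w, y} \<in> E"
      using twin_edge_trans[OF t, of x w y] eE f False by (auto simp: insert_commute[of w x])
    then show ?thesis using y by auto
  qed
  then obtain y where y: "{p, p', w, y} \<in> E" "y \<noteq> x" by blast
  have yw: "y \<noteq> w" "y \<noteq> p" "y \<noteq> p'"
    using card_edge[OF y(1)] pd by (auto simp: insert_commute)
  have ym: "{p, p', w, y} \<in> mixed"
    using mixedI[OF y(1), of p w] pt w by auto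
  have "y \<notin> twins"
  proof
    assume "y \<in> twins"
    obtain q q' z where q: "twin q q'" "{p, p', w, y} = {q, q', w, z}" "z \<notin> twins" "z \<noteq> w"
      by (rule mixedE[OF ym, of w]) (use w in auto)
    then have "z \<in> {p, p', y}" by blast
    then show False using pt \<open>y \<in> twins\<close> q(3) by blast
  qed
  then show ?thesis
    using that[OF t _ ym x(1) _ y(2)[symmetric] x(2) yw(1)] e unfolding e_eq by blast
qed

definition mixed_vertices :: "'a set" where
  "mixed_vertices = \<Union>mixed - twins"

definition plain :: "'a set set" where
  "plain = {e \<in> E. e \<inter> twins = {}}"

lemma finite_mixed: "finite mixed" "finite mixed_vertices"
proof -
  have sub: "mixed \<subseteq> E" by (auto simp: mixed_def)
  then show "finite mixed" using finite_E finite_subset by blast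
  have "mixed_vertices \<subseteq> V"
    using sub edge_subset by (fastforce simp: mixed_vertices_def)
  then show "finite mixed_vertices" using finite_V finite_subset by blast
qed

lemma mixed_degree:
  assumes "w \<in> mixed_vertices"
  shows "2 \<le> card {e \<in> mixed. w \<in> e}"
proof -
  obtain e where "e \<in> mixed" "w \<in> e" "w \<notin> twins"
    using assms by (auto simp: mixed_vertices_def)
  then obtain p p' x y where *: "twin p p'" "{p, p', w, x} \<in> mixed" "{p, p', w, y} \<in> mixed"
    "x \<notin> twins" "y \<notin> twins" "x \<noteq> y" "x \<noteq> w" "y \<noteq> w"
    by (rule mixed_vertex)
  have "p \<in> twins" "p' \<in> twins" using twin_in_twins[OF *(1)] by simp_all
  then have "x \<notin> {p, p', w, y}" using * by auto
  then have "{p, p', w, x} \<noteq> {p, p', w, y}" by blast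
  then have "2 = card {{p, p', w, x}, {p, p', w, y}}" by simp
  also have "\<dots> \<le> card {e \<in> mixed. w \<in> e}"
    using * finite_mixed by (intro card_mono) auto
  finally show ?thesis .
qed

text \<open>Double counting of incidences: besides its twin pair, a mixed edge has room for only two
  vertices. With \<open>mixed_degree\<close> this gives \<open>mixed_bound\<close>.\<close>

lemma mixed_sum:
  "(\<Sum>w\<in>mixed_vertices. card {e \<in> mixed. w \<in> e}) \<le> 2 * card mixed"
proof -
  have "(\<Sum>w\<in>mixed_vertices. card {e \<in> mixed. w \<in> e}) = (\<Sum>e\<in>mixed. card {w \<in> mixed_vertices. w \<in> e})"
    using finite_mixed by (intro sum_multicount_gen) auto
  also have "\<dots> \<le> (\<Sum>e\<in>mixed. 2)"
  proof (rule sum_mono)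
    fix e assume e: "e \<in> mixed"
    show "card {w \<in> mixed_vertices. w \<in> e} \<le> 2"
    proof (cases "\<exists>w\<in>e. w \<notin> twins")
      case True
      then obtain w where "w \<in> e" "w \<notin> twins" by blast
      then obtain p p' x where *: "twin p p'" "e = {p, p', w, x}"
        using e by (metis mixedE)
      have "{w \<in> mixed_vertices. w \<in> e} \<subseteq> {w, x}"
        using *(2) twin_in_twins[OF *(1)] by (auto simp: mixed_vertices_def)
      then have "card {w \<in> mixed_vertices. w \<in> e} \<le> card {w, x}"
        by (intro card_mono) auto
      then show ?thesis by (auto simp: card_insert_if split: if_splits)
    next
      case False
      then have eq: "{w \<in> mixed_vertices. w \<in> e} = {}"
        by (auto simp: mixed_vertices_def)
      show ?thesis unfolding eq by simp
    qed
  qed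
  finally show ?thesis by (simp add: mult.commute)
qed

lemma mixed_bound: "card mixed_vertices \<le> card mixed"
proof -
  have "(\<Sum>w\<in>mixed_vertices. 2) \<le> (\<Sum>w\<in>mixed_vertices. card {e \<in> mixed. w \<in> e})"
    by (rule sum_mono) (rule mixed_degree)
  with mixed_sum show ?thesis by simp
qed

text \<open>A plain edge through a mixed vertex \<open>w\<close> avoids the twin pair, so by
  \<open>edge_pair_agree\<close> it also contains the two neighbours \<open>x\<close> and
  \<open>y\<close> of \<open>w\<close>, and these are mixed vertices too.\<close>

lemma plain_mixed_inter:
  assumes h: "h \<in> plain" and ne: "h \<inter> mixed_vertices \<noteq> {}"
  shows "card (h - mixed_vertices) \<le> 1"
proof -
  obtain w where w: "w \<in> h" "w \<in> mixed_vertices" using ne by blast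
  then obtain e where "e \<in> mixed" "w \<in> e" "w \<notin> twins"
    by (auto simp: mixed_vertices_def)
  then obtain p p' x y where *: "twin p p'" "{p, p', w, x} \<in> mixed" "{p, p', w, y} \<in> mixed"
    "x \<notin> twins" "y \<notin> twins" "x \<noteq> y" "x \<noteq> w" "y \<noteq> w"
    by (rule mixed_vertex)
  have hE: "h \<in> E" "h \<inter> twins = {}" using h by (auto simp: plain_def)
  then have "p \<notin> h" using twin_in_twins[OF *(1)] by blast
  moreover have "{p, p', w, x} \<in> E" "{p, p', w, y} \<in> E" using * by (auto simp: mixed_def)
  ultimately have "x \<in> h" "y \<in> h"
    using edge_pair_agree[OF *(1) _ hE(1)] w(1) by blast+
  moreover have "x \<in> mixed_vertices" "y \<in> mixed_vertices"
    using *(2-5) unfolding mixed_vertices_def by blast+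
  ultimately have "card {w, x, y} \<le> card (h \<inter> mixed_vertices)"
    using w finite_edge[OF hE(1)] by (intro card_mono) auto
  then have "3 \<le> card (h \<inter> mixed_vertices)" using * by simp
  then show ?thesis
    using card_edge[OF hE(1)] finite_edge[OF hE(1)] by (simp add: card_Diff_subset_Int)
qed

text \<open>Plain edges split into \<open>E0\<close>, avoiding the mixed vertices, and
  \<open>E1\<close>, meeting them. \<open>E0\<close> is a saturated family of its own without twins,
  so \<open>twin_free_bound\<close> applies to it. Each edge of \<open>E1\<close> contains at most
  one of the remaining vertices.\<close>

lemma plain_bound: "card (\<Union>E - twins - mixed_vertices) \<le> card plain"
proof -
  define R where "R = \<Union>E - twins - mixed_vertices"
  define E0 where "E0 = {f \<in> plain. f \<inter> mixed_vertices = {}}"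
  define E1 where "E1 = {f \<in> plain. f \<inter> mixed_vertices \<noteq> {}}"
  have R_plain: "e \<in> plain" if "e \<in> E" "s \<in> e" "s \<in> R" for e s
  proof (rule ccontr)
    assume "e \<notin> plain"
    then have "e \<in> mixed" using that by (auto simp: plain_def mixed_def R_def)
    then show False using that by (auto simp: mixed_vertices_def R_def)
  qed
  have plain_E: "plain \<subseteq> E" by (auto simp: plain_def)
  have fin: "finite plain" "finite E0" "finite E1"
    using finite_subset[OF plain_E finite_E] by (auto simp: E0_def E1_def)
  have V0: "\<Union>E0 \<subseteq> R"
    using plain_E by (auto simp: E0_def R_def plain_def)
  \<comment> \<open>An edge meeting the mixed vertices has at most one vertex elsewhere, so it would
    meet an edge of \<open>E0\<close> in exactly one vertex.\<close>
  have closed: "e \<in> E0" if e: "e \<in> E" "e \<inter> \<Union>E0 \<noteq> {}" for e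
  proof -
    obtain s k where s: "s \<in> e" "s \<in> k" "k \<in> E0" using e by blast
    have ep: "e \<in> plain" using R_plain e(1) s V0 by blast
    moreover have "e \<inter> mixed_vertices = {}"
    proof (rule ccontr)
      assume ne: "e \<inter> mixed_vertices \<noteq> {}"
      have "card (e \<inter> k) \<le> card (e - mixed_vertices)"
        using s finite_edge[OF e(1)] by (intro card_mono) (auto simp: E0_def)
      then have "card (e \<inter> k) \<le> 1" using plain_mixed_inter[OF ep ne] by simp
      moreover have "card (e \<inter> k) \<noteq> 0" using s finite_edge[OF e(1)] by auto
      moreover have "card (e \<inter> k) \<noteq> 1"
        using edge_inter[OF e(1)] s(3) plain_E by (auto simp: E0_def)
      ultimately show False by linarith
    qed
    ultimately show ?thesis by (simp add: E0_def)
  qed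
  have RV: "R \<subseteq> V" using edge_subset by (auto simp: R_def)
  have "card (\<Union>E0) \<le> card E0"
  proof (rule twin_free_bound)
    show "saturated (\<Union>E0) E0"
    proof (rule saturated_closed)
      fix e assume "e \<in> E0"
      then show "e \<in> E \<and> e \<subseteq> \<Union>E0" using plain_E by (auto simp: E0_def)
    next
      show "\<Union>E0 \<subseteq> V" using V0 RV by blast
    qed (fact closed)
    show "separates E0 (\<Union>E0)"
      unfolding separates_def
    proof (intro ballI impI)
      fix x y assume xy: "x \<in> \<Union>E0" "y \<in> \<Union>E0" "x \<noteq> y"
      then have "x \<in> V" "y \<in> V" "x \<notin> twins" using V0 RV by (auto simp: R_def)
      then obtain e where "e \<in> E" "(x \<in> e) \<noteq> (y \<in> e)"
        using xy(3) unfolding twins_def twin_def by blast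
      \<comment> \<open>The separating edge meets the union of \<open>E0\<close>, so it belongs to
        \<open>E0\<close> itself.\<close>
      then show "\<exists>e\<in>E0. (x \<in> e) \<noteq> (y \<in> e)"
        using closed xy by (intro bexI[of _ e]) blast+
    qed
  qed simp
  moreover have "card (R - \<Union>E0) \<le> card E1"
  proof -
    have "R - \<Union>E0 \<subseteq> (\<Union>f\<in>E1. f - mixed_vertices)"
    proof
      fix s assume s: "s \<in> R - \<Union>E0"
      then obtain e where e: "e \<in> E" "s \<in> e" by (auto simp: R_def)
      then have "e \<in> plain" using R_plain s by blast
      then have "e \<in> E1" using s e by (auto simp: E0_def E1_def)
      then show "s \<in> (\<Union>f\<in>E1. f - mixed_vertices)" using s e by (auto simp: R_def)
    qed
    then have "card (R - \<Union>E0) \<le> card (\<Union>f\<in>E1. f - mixed_vertices)"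
      by (intro card_mono finite_UN_I fin) (use finite_edge plain_E in \<open>auto simp: E1_def\<close>)
    also have "\<dots> \<le> (\<Sum>f\<in>E1. card (f - mixed_vertices))"
      using fin by (intro card_UN_le)
    also have "\<dots> \<le> (\<Sum>f\<in>E1. 1)"
      by (intro sum_mono plain_mixed_inter) (auto simp: E1_def)
    finally show ?thesis by simp
  qed
  moreover have "card plain = card E0 + card E1"
    using fin by (subst card_Un_disjoint[symmetric]) (auto simp: E0_def E1_def intro: arg_cong[where f = card])
  moreover have "card R = card (R - \<Union>E0) + card (\<Union>E0)"
    using V0 finite_subset[OF RV finite_V]
    by (metis card_Diff_subset card_mono finite_subset le_add_diff_inverse2)
  ultimately show ?thesis unfolding R_def by linarith
qed

section \<open>Comparison of the vertex classes with the edge classes\<close>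

definition paired :: "'a set set" where
  "paired = {e \<in> E. e \<subseteq> twins}"

lemma twins_subset: "twins \<subseteq> V"
  using twinD(1) by (auto simp: twins_def)

lemma card_edges_split: "card E = card paired + card mixed + card plain"
proof -
  have "e \<noteq> {}" if "e \<in> E" for e using card_edge[OF that] by auto
  then have "E = paired \<union> mixed \<union> plain" "paired \<inter> mixed = {}" "(paired \<union> mixed) \<inter> plain = {}"
    unfolding paired_def mixed_def plain_def by blast+
  then show ?thesis
    using finite_E by (metis card_Un_disjoint finite_Un)
qed

text \<open>The last two classes are paid for by the mixed and the plain edges. The twins and the
  uncovered twinless vertices remain, to be compared with the paired edges.\<close>

lemma card_vertices_split:
  "card V = card twins + card (V - twins - \<Union>E) +
     (card mixed_vertices + card (\<Union>E - twins - mixed_vertices))"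
proof -
  have mv: "mixed_vertices \<subseteq> \<Union>E" "mixed_vertices \<inter> twins = {}"
    by (auto simp: mixed_vertices_def mixed_def)
  have UE: "\<Union>E \<subseteq> V" using edge_subset by auto
  let ?U = "V - twins - \<Union>E" and ?R = "\<Union>E - twins - mixed_vertices"
  have fin: "finite twins" "finite ?U" "finite mixed_vertices" "finite ?R"
    using finite_subset[OF twins_subset] finite_subset[OF UE] finite_V finite_mixed by auto
  have "V = (twins \<union> ?U) \<union> (mixed_vertices \<union> ?R)"
    using mv UE twins_subset by blast
  then have "card V = card ((twins \<union> ?U) \<union> (mixed_vertices \<union> ?R))" by simp
  also have "\<dots> = card (twins \<union> ?U) + card (mixed_vertices \<union> ?R)"
    using fin mv by (intro card_Un_disjoint) auto
  also have "card (twins \<union> ?U) = card twins + card ?U"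
    using fin by (intro card_Un_disjoint) auto
  also have "card (mixed_vertices \<union> ?R) = card mixed_vertices + card ?R"
    using fin by (intro card_Un_disjoint) auto
  finally show ?thesis .
qed

text \<open>Two vertices in no edge are twins of each other.\<close>

lemma card_uncovered: "card (V - twins - \<Union>E) \<le> 1"
proof (rule ccontr)
  assume "\<not> ?thesis"
  then obtain x y where "x \<in> V - twins - \<Union>E" "y \<in> V - twins - \<Union>E" "x \<noteq> y"
    using card_le_Suc0_iff_eq[of "V - twins - \<Union>E"] finite_V by auto
  then have "twin x y" by (auto simp: twin_def)
  then show False using \<open>x \<in> V - twins - \<Union>E\<close> twin_in_twins(1) by blast
qed

text \<open>Let \<open>x\<close> and \<open>y\<close> be neighbours of \<open>w\<close> over a twin
  pair. The four-set \<open>{u, w, x, y}\<close> is not an edge, as \<open>u\<close> is uncovered,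
  so some edge \<open>k\<close> meets it once. This edge must contain the twin pair and leads to a
  third mixed edge through \<open>w\<close>, which makes the double counting strict.\<close>

lemma mixed_strict_bound:
  assumes u: "u \<in> V" "u \<notin> \<Union>E" and ne: "mixed \<noteq> {}"
  shows "card mixed_vertices < card mixed"
proof -
  obtain e w0 where "e \<in> mixed" "w0 \<in> e" "w0 \<notin> twins"
    using ne by (auto simp: mixed_def)
  then obtain p p' w x y where *: "twin p p'" "{p, p', w, x} \<in> mixed" "{p, p', w, y} \<in> mixed"
    "x \<notin> twins" "y \<notin> twins" "x \<noteq> y" "x \<noteq> w" "y \<noteq> w" "w \<notin> twins"
    using mixed_vertex by metis
  have pt: "p \<in> twins" "p' \<in> twins" using twin_in_twins[OF *(1)] by simp_all
  have wx: "{p, p', w, x} \<in> E" and wy: "{p, p', w, y} \<in> E" using *(2,3) by (auto simp: mixed_def)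
  have "u \<notin> {p, p', w, x}" "u \<notin> {p, p', w, y}" using wx wy u by blast+
  then have "card {u, w, x, y} = 4" using * by auto
  moreover have "{u, w, x, y} \<subseteq> V" using u edge_subset[OF wx] edge_subset[OF wy] by auto
  moreover have "{u, w, x, y} \<notin> E" using u by auto
  ultimately obtain k v where k: "k \<in> E" "{u, w, x, y} \<inter> k = {v}"
    using not_edge_hit[of u w x y] by auto
  have "u \<notin> k" using u k by auto
  then have v: "v \<in> {w, x, y}" "v \<in> k" using k(2) by auto
  have "r = v" if "r \<in> {w, x, y}" "r \<in> k" for r
    using that k(2) by blast
  then have "\<not> (w \<in> k \<and> x \<in> k)" "\<not> (w \<in> k \<and> y \<in> k)" "\<not> (x \<in> k \<and> y \<in> k)"
    using *(6-8) by (metis insertCI)+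
  \<comment> \<open>Without \<open>p\<close>, the edge \<open>k\<close> would contain all or none of
    \<open>w\<close>, \<open>x\<close>, \<open>y\<close>, but it contains exactly one of
    them.\<close>
  then have pk: "p \<in> k"
    using edge_pair_agree[OF *(1) wx k(1)] edge_pair_agree[OF *(1) wy k(1)] v by blast
  moreover from this have "p' \<in> k" using twin_iff[OF *(1) k(1)] by simp
  moreover have "p \<noteq> p'" "p \<noteq> v" "p' \<noteq> v" using twinD(3)[OF *(1)] pt * v by auto
  ultimately obtain z where z: "k = {p, p', v, z}" "z \<noteq> p" "z \<noteq> p'" "z \<noteq> v"
    using edge_with_pairE[OF k(1), of p p' v] v by auto
  have zn: "z \<notin> {w, x, y}" using k(2) z v by auto
  \<comment> \<open>For \<open>v = w\<close> this is \<open>k\<close> itself; for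
    \<open>v = x\<close> or \<open>v = y\<close> transitivity moves the neighbour \<open>z\<close>
    over to \<open>w\<close>.\<close>
  have "{p, p', w, z} \<in> E"
    using twin_edge_trans[OF *(1), of v w z] v k(1) z(1) zn wx wy
    by (auto simp: insert_commute[of x w] insert_commute[of y w])
  then have wz: "{p, p', w, z} \<in> mixed"
    using mixedI[of "{p, p', w, z}" p w] pt *(9) by simp
  have "x \<notin> {p, p', w, y}" "x \<notin> {p, p', w, z}" "y \<notin> {p, p', w, z}"
    using * pt zn by auto
  then have dist: "{p, p', w, x} \<noteq> {p, p', w, y}" "{p, p', w, x} \<noteq> {p, p', w, z}"
    "{p, p', w, y} \<noteq> {p, p', w, z}"
    by blast+
  have "3 = card {{p, p', w, x}, {p, p', w, y}, {p, p', w, z}}"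
    using dist by simp
  also have "\<dots> \<le> card {e \<in> mixed. w \<in> e}"
    using * wz finite_mixed by (intro card_mono) auto
  finally have three: "3 \<le> card {e \<in> mixed. w \<in> e}" .
  have w: "w \<in> mixed_vertices" using *(2,9) unfolding mixed_vertices_def by blast
  \<comment> \<open>Every mixed vertex has degree at least two, and \<open>w\<close> has degree at
    least three.\<close>
  have "2 * card (mixed_vertices - {w}) = (\<Sum>v\<in>mixed_vertices - {w}. 2)" by simp
  also have "\<dots> \<le> (\<Sum>v\<in>mixed_vertices - {w}. card {e \<in> mixed. v \<in> e})"
    by (rule sum_mono) (use mixed_degree in auto)
  finally have "2 * card (mixed_vertices - {w}) + 3 \<le> (\<Sum>v\<in>mixed_vertices. card {e \<in> mixed. v \<in> e})"
    using three w finite_mixed by (simp add: sum.remove[of mixed_vertices w])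
  moreover have "card mixed_vertices = card (mixed_vertices - {w}) + 1"
    using card.remove[OF finite_mixed(2) w] by simp
  ultimately show ?thesis using mixed_sum by linarith
qed

text \<open>Three mutual twins force all twins into one class, which has three vertices or consists
  of the four vertices of an edge, and they leave no uncovered twinless vertex.\<close>

lemma twin_triple_bound:
  assumes abc: "twin a b" "twin a c" "b \<noteq> c"
  shows "card twins + card (V - twins - \<Union>E) \<le> card paired + 3"
proof -
  have ne: "a \<noteq> b" "a \<noteq> c" using twinD(3) abc by auto
  \<comment> \<open>A twin pair outside the class of \<open>a\<close> would form an edge with
    \<open>{a, b}\<close> that omits \<open>c\<close>, a twin of \<open>a\<close>.\<close>
  have cls: "twin a x" if x: "x \<in> twins" "x \<noteq> a" for x
  proof (rule ccontr)
    assume n: "\<not> twin a x"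
    obtain y where y: "twin x y" using x by (auto simp: twins_def)
    have nx: "x \<noteq> b" "x \<noteq> c" using n abc by auto
    have ny: "y \<noteq> a" "y \<noteq> b" "y \<noteq> c"
      using n y abc twin_sym twin_trans x(2) by metis+
    have "{a, b, x, y} \<in> E"
      by (rule twin_pairs_edge[OF abc(1) y]) (use nx ny x in auto)
    then have "c \<in> {a, b, x, y}" using twin_iff[OF abc(2)] by blast
    then show False using ne abc(3) nx ny by auto
  qed
  \<comment> \<open>Every edge contains all or none of \<open>a\<close>, \<open>b\<close>,
    \<open>c\<close>, and never \<open>u\<close>, so nothing could meet \<open>{u, a, b, c}\<close>
    once.\<close>
  have uncov: "V - twins - \<Union>E = {}"
  proof (rule ccontr)
    assume "V - twins - \<Union>E \<noteq> {}"
    then obtain u where u: "u \<in> V" "u \<notin> twins" "u \<notin> \<Union>E" by auto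
    have "a \<in> twins" "b \<in> twins" "c \<in> twins" using twin_in_twins abc by auto
    moreover from this have "u \<notin> {a, b, c}" using u(2) by blast
    ultimately have "card {u, a, b, c} = 4" "{u, a, b, c} \<subseteq> V" "{u, a, b, c} \<notin> E"
      using u ne abc(3) twins_subset by auto
    then obtain k v where k: "k \<in> E" "{u, a, b, c} \<inter> k = {v}"
      using not_edge_hit[of u a b c] by auto
    moreover have "u \<notin> k" using u k by auto
    ultimately show False
      using twin_iff[OF abc(1) k(1)] twin_iff[OF abc(2) k(1)] ne
      by (cases "a \<in> k") (auto simp: Int_insert_left)
  qed
  show ?thesis
  proof (cases "twins \<subseteq> {a, b, c}")
    case True
    then have "card twins \<le> card {a, b, c}" by (intro card_mono) auto
    also have "\<dots> = 3" using ne abc(3) by simp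
    finally show ?thesis unfolding uncov by simp
  next
    case False
    then obtain d where d: "d \<in> twins" "d \<noteq> a" "d \<noteq> b" "d \<noteq> c" by auto
    have cd: "twin c d" using twin_trans[OF twin_sym[OF abc(2)] cls[OF d(1,2)]] d by auto
    have edge: "{a, b, c, d} \<in> E"
      by (rule twin_pairs_edge[OF abc(1) cd]) (use ne abc(3) d in auto)
    \<comment> \<open>A twin of \<open>a\<close> lies on every edge through \<open>a\<close>, in
      particular on this one.\<close>
    have "twins \<subseteq> {a, b, c, d}"
    proof
      fix x assume "x \<in> twins"
      then have "x = a \<or> twin a x" using cls by blast
      then show "x \<in> {a, b, c, d}" using twin_iff[OF _ edge, of a x] by auto
    qed
    then have "card twins \<le> card {a, b, c, d}" by (intro card_mono) auto
    then have "card twins \<le> 4" using card_edge[OF edge] by simp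
    moreover have "{a, b, c, d} \<in> paired"
      using edge d twin_in_twins abc by (auto simp: paired_def)
    then have "card paired \<noteq> 0"
      using finite_E by (auto simp: paired_def)
    ultimately show ?thesis unfolding uncov by simp
  qed
qed

section \<open>Twin classes of size two and the final count\<close>

definition twin_pairs :: "'a set set" where
  "twin_pairs = {{x, y} | x y. twin x y}"

lemma twin_pairsE:
  assumes "X \<in> twin_pairs"
  obtains x y where "X = {x, y}" "twin x y"
  using assms by (auto simp: twin_pairs_def)

lemma twin_pairs_eq:
  assumes uniq: "\<forall>a b c. twin a b \<longrightarrow> twin a c \<longrightarrow> b = c"
    and "X \<in> twin_pairs" "Y \<in> twin_pairs" "z \<in> X" "z \<in> Y"
  shows "X = Y"
proof -
  have "\<exists>y. twin z y \<and> Z = {z, y}" if Z: "Z \<in> twin_pairs" "z \<in> Z" for Z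
  proof -
    obtain x y where "Z = {x, y}" "twin x y" using Z by (auto simp: twin_pairs_def)
    then show ?thesis using Z(2) twin_sym by (metis insert_commute insertE singletonD)
  qed
  from this[OF assms(2,4)] this[OF assms(3,5)] show ?thesis using uniq by blast
qed

lemma twin_pairs_structure:
  assumes uniq: "\<forall>a b c. twin a b \<longrightarrow> twin a c \<longrightarrow> b = c"
  shows "\<Union>twin_pairs = twins" "finite twin_pairs" "card twins = 2 * card twin_pairs"
proof -
  have disj: "pairwise disjnt twin_pairs"
    unfolding pairwise_def disjnt_def using twin_pairs_eq[OF uniq] by blast
  show U: "\<Union>twin_pairs = twins"
    unfolding twin_pairs_def twins_def using twin_sym by blast
  have fin: "finite X" "card X = 2" if "X \<in> twin_pairs" for X
    using that twinD(3) unfolding twin_pairs_def by fastforce+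
  have "finite twins" using finite_subset[OF twins_subset finite_V] .
  then show "finite twin_pairs" using U finite_UnionD by metis
  show "card twins = 2 * card twin_pairs"
    unfolding U[symmetric] using card_Union_disjoint[OF disj] fin by simp
qed

text \<open>Any two twin pairs have an edge as their union. Different choices give different edges
  because the pairs are disjoint: the choice is recovered as the set of twin pairs inside the
  union.\<close>

lemma twin_pairs_choose:
  assumes uniq: "\<forall>a b c. twin a b \<longrightarrow> twin a c \<longrightarrow> b = c"
  shows "card twin_pairs choose 2 \<le> card paired"
proof -
  note st = twin_pairs_structure[OF uniq]
  let ?S = "{X. X \<subseteq> twin_pairs \<and> card X = 2}"
  have rec: "X = {P \<in> twin_pairs. P \<subseteq> \<Union>X}" if "X \<in> ?S" for X
  proof (rule equalityI; rule subsetI)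
    fix P assume P: "P \<in> {P \<in> twin_pairs. P \<subseteq> \<Union>X}"
    then obtain z where z: "z \<in> P" by (auto simp: twin_pairs_def)
    then obtain Q where "Q \<in> X" "z \<in> Q" using P by blast
    then have "Q = P"
      using P z that by (intro twin_pairs_eq[OF uniq, of Q P z]) auto
    then show "P \<in> X" using \<open>Q \<in> X\<close> by simp
  qed (use that in auto)
  have "inj_on Union ?S"
  proof (rule inj_onI)
    fix X Y assume X: "X \<in> ?S" and Y: "Y \<in> ?S" and eq: "\<Union>X = \<Union>Y"
    show "X = Y"
      using rec[OF X] unfolding eq rec[OF Y, symmetric] .
  qed
  moreover have "Union ` ?S \<subseteq> paired"
  proof
    fix e assume "e \<in> Union ` ?S"
    then obtain X where "X \<subseteq> twin_pairs" "card X = 2" "e = \<Union>X" by blast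
    then obtain P Q where PQ: "P \<in> twin_pairs" "Q \<in> twin_pairs" "P \<noteq> Q" "e = P \<union> Q"
      by (auto simp: card_2_iff)
    then obtain a b c d where ab: "twin a b" "twin c d" "P = {a, b}" "Q = {c, d}"
      by (auto simp: twin_pairs_def)
    have "{a, b} \<inter> {c, d} = {}"
      using twin_pairs_eq[OF uniq PQ(1,2)] PQ(3) ab(3,4) by blast
    then have "{a, b, c, d} \<in> E" using twin_pairs_edge ab by blast
    moreover have "{a, b, c, d} \<subseteq> twins" using twin_in_twins ab(1,2) by auto
    ultimately show "e \<in> paired"
      using PQ ab by (simp add: paired_def insert_commute)
  qed
  moreover have "finite paired" using finite_E by (simp add: paired_def)
  ultimately have "card ?S \<le> card paired"
    by (metis card_image card_mono)
  then show ?thesis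
    using n_subsets[OF st(2)] by simp
qed

text \<open>The uncovered vertex \<open>u\<close> together with a suitable triple of twins is not an
  edge. The triple is chosen such that an edge meeting it once contains exactly one twin pair and no
  other twin, so that it is mixed.\<close>

lemma mixed_nonempty:
  assumes uniq: "\<forall>a b c. twin a b \<longrightarrow> twin a c \<longrightarrow> b = c"
    and u: "u \<in> V" "u \<notin> twins" "u \<notin> \<Union>E"
    and m: "card twin_pairs \<in> {2, 3}"
  shows "mixed \<noteq> {}"
proof -
  note st = twin_pairs_structure[OF uniq]
  \<comment> \<open>An edge has more vertices than the pair \<open>P\<close>, and by assumption the
    others have no twins.\<close>
  have single: ?thesis
    if k: "k \<in> E" and P: "P \<in> twin_pairs" "P \<subseteq> k" "k \<inter> (twins - P) = {}" for k P
  proof -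
    obtain x y where xy: "P = {x, y}" "twin x y" using P(1) by (auto simp: twin_pairs_def)
    have "\<not> k \<subseteq> P"
      using card_mono[of P k] card_edge[OF k] xy by (auto simp: card_insert_if split: if_splits)
    moreover have "x \<in> k" "x \<in> twins" using xy P twin_in_twins by auto
    ultimately have "k \<in> mixed" using k P(3) unfolding mixed_def by blast
    then show ?thesis by blast
  qed
  \<comment> \<open>As \<open>u\<close> lies on no edge, the single common vertex belongs to the
    triple.\<close>
  have hit3: "\<exists>k\<in>E. \<exists>v\<in>{a, b, c}. {a, b, c} \<inter> k = {v}"
    if "a \<in> twins" "b \<in> twins" "c \<in> twins" "card {a, b, c} = 3" for a b c
  proof -
    have "u \<notin> {a, b, c}" using that u by blast
    then have "card {u, a, b, c} = 4" using that(4) by simp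
    moreover have "{u, a, b, c} \<subseteq> V" "{u, a, b, c} \<notin> E"
      using that(1-3) u twins_subset by auto
    ultimately obtain k v where k: "k \<in> E" "{u, a, b, c} \<inter> k = {v}"
      using not_edge_hit[of u a b c] by auto
    moreover have "u \<notin> k" using u k(1) by blast
    ultimately show ?thesis by (intro bexI[of _ k]) auto
  qed
  from m consider "card twin_pairs = 2" | "card twin_pairs = 3" by blast
  then show ?thesis
  proof cases
    case 1
    then obtain P Q where PQ: "twin_pairs = {P, Q}" "P \<noteq> Q" by (auto simp: card_2_iff)
    then have "P \<in> twin_pairs" "Q \<in> twin_pairs" by auto
    then obtain a a' b b' where t: "P = {a, a'}" "twin a a'" "Q = {b, b'}" "twin b b'"
      by (elim twin_pairsE)
    have disj: "P \<inter> Q = {}" using twin_pairs_eq[OF uniq, of P Q] PQ by auto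
    have U: "twins = P \<union> Q" using st(1) PQ by auto
    \<comment> \<open>An edge meeting this triple once cannot contain \<open>a\<close> or
      \<open>a'\<close>, so it contains \<open>b\<close> and hence all of \<open>Q\<close>. With
      three pairs, one vertex of each pair serves as the triple.\<close>
    have "card {a, a', b} = 3" using t disj twinD(3) by auto
    then obtain k v where k: "k \<in> E" "{a, a', b} \<inter> k = {v}"
      using hit3[of a a' b] U t by auto
    have "a \<notin> k" "a' \<notin> k"
      using k twin_iff[OF t(2) k(1)] twinD(3)[OF t(2)] by auto
    moreover have "v \<in> {a, a', b} \<inter> k" unfolding k(2) by simp
    ultimately have b: "b \<in> k" by auto
    then have "b' \<in> k" using twin_iff[OF t(4) k(1)] by simp
    then have "Q \<subseteq> k" "k \<inter> (twins - Q) = {}"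
      using b \<open>a \<notin> k\<close> \<open>a' \<notin> k\<close> U t(1,3) by auto
    then show ?thesis
      using single[OF k(1) \<open>Q \<in> twin_pairs\<close>] by simp
  next
    case 2
    then obtain P Q R where PQ: "twin_pairs = {P, Q, R}" "P \<noteq> Q" "P \<noteq> R" "Q \<noteq> R"
      by (auto simp: card_3_iff)
    then have "P \<in> twin_pairs" "Q \<in> twin_pairs" "R \<in> twin_pairs" by auto
    then obtain a a' b b' c c' where t: "P = {a, a'}" "twin a a'" "Q = {b, b'}" "twin b b'"
      "R = {c, c'}" "twin c c'"
      by (elim twin_pairsE)
    have disj: "P \<inter> Q = {}" "P \<inter> R = {}" "Q \<inter> R = {}"
      using twin_pairs_eq[OF uniq, of P Q] twin_pairs_eq[OF uniq, of P R]
        twin_pairs_eq[OF uniq, of Q R] PQ by auto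
    have U: "twins = P \<union> Q \<union> R" using st(1) PQ by auto
    have abc: "a \<noteq> b" "a \<noteq> c" "b \<noteq> c" using t disj by auto
    then have "card {a, b, c} = 3" by simp
    then obtain k v where k: "k \<in> E" "v \<in> {a, b, c}" "{a, b, c} \<inter> k = {v}"
      using hit3[of a b c] U t by auto
    note iff = twin_iff[OF t(2) k(1)] twin_iff[OF t(4) k(1)] twin_iff[OF t(6) k(1)]
    have "v \<in> {a, b, c} \<inter> k" unfolding k(3) by simp
    then have kv: "v \<in> k" by simp
    have only: "r = v" if "r \<in> {a, b, c}" "r \<in> k" for r
      using that k(3) by blast
    from k(2) consider "v = a" | "v = b" | "v = c" by blast
    then show ?thesis
    proof cases
      case 1
      then have "P \<subseteq> k" "k \<inter> (twins - P) = {}"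
        using kv only[of b] only[of c] abc iff unfolding U t by auto
      then show ?thesis using single[OF k(1) \<open>P \<in> twin_pairs\<close>] by simp
    next
      case 2
      then have "Q \<subseteq> k" "k \<inter> (twins - Q) = {}"
        using kv only[of a] only[of c] abc iff unfolding U t by auto
      then show ?thesis using single[OF k(1) \<open>Q \<in> twin_pairs\<close>] by simp
    next
      case 3
      then have "R \<subseteq> k" "k \<inter> (twins - R) = {}"
        using kv only[of a] only[of b] abc iff unfolding U t by auto
      then show ?thesis using single[OF k(1) \<open>R \<in> twin_pairs\<close>] by simp
    qed
  qed
qed

text \<open>By the class bounds, \<open>m\<close> twin pairs leave \<open>2 * m\<close>, plus one if
  some vertex is uncovered, to be compared with \<open>(m choose 2) + 3\<close>. The comparison
  fails only for \<open>m\<close> equal to 2 or 3 with an uncovered vertex, and then by one; the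
  strict bound on mixed edges makes up for it.\<close>

lemma card_vertices_le: "card V \<le> card E + 3"
proof (cases "\<exists>a b c. twin a b \<and> twin a c \<and> b \<noteq> c")
  case True
  then have "card twins + card (V - twins - \<Union>E) \<le> card paired + 3"
    using twin_triple_bound by blast
  then show ?thesis
    using card_edges_split card_vertices_split mixed_bound plain_bound by linarith
next
  case False
  then have uniq: "\<forall>a b c. twin a b \<longrightarrow> twin a c \<longrightarrow> b = c" by blast
  define m where "m = card twin_pairs"
  have m: "card twins = 2 * m" "m choose 2 \<le> card paired"
    using twin_pairs_structure(3)[OF uniq] twin_pairs_choose[OF uniq] by (simp_all add: m_def)
  \<comment> \<open>The constant 2 in place of 3 leaves room for one uncovered vertex.\<close>
  have big: "2 * k \<le> (k choose 2) + 2" if "4 \<le> k" for k :: nat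
    using that
  proof (induction k rule: dec_induct)
    case (step k)
    then show ?case by (simp add: numeral_2_eq_2)
  qed (simp add: numeral_eq_Suc)
  have small: "2 choose 2 = (1::nat)" "3 choose 2 = (3::nat)" by (simp_all add: numeral_eq_Suc)
  show ?thesis
  proof (cases "V - twins - \<Union>E = {} \<or> m \<notin> {2, 3}")
    case True
    have "2 * m + card (V - twins - \<Union>E) \<le> (m choose 2) + 3"
    proof (cases "m \<in> {2, 3}")
      case True
      then have "card (V - twins - \<Union>E) = 0"
        using \<open>V - twins - \<Union>E = {} \<or> m \<notin> {2, 3}\<close> by (metis card.empty)
      then show ?thesis using True small by auto
    next
      case False
      then have "m \<le> 1 \<or> 4 \<le> m" by auto
      then show ?thesis using big[of m] card_uncovered by auto
    qed
    then show ?thesis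
      using m card_edges_split card_vertices_split mixed_bound plain_bound by linarith
  next
    case False
    then obtain u where "u \<in> V" "u \<notin> twins" "u \<notin> \<Union>E" by auto
    then have "card mixed_vertices < card mixed"
      using mixed_strict_bound mixed_nonempty[OF uniq] False unfolding m_def by blast
    moreover have "2 * m \<le> (m choose 2) + 3" using False small by auto
    ultimately show ?thesis
      using m card_edges_split card_vertices_split plain_bound card_uncovered by linarith
  qed
qed

end

subsection \<open>Extremal families\<close>

text \<open>The list \<open>rows d 4\<close> also contains vectors of smaller weight, hence the
  guard \<open>weight g = 4\<close>.\<close>

definition saturated_rows :: "nat \<Rightarrow> bool list list \<Rightarrow> bool" where
  "saturated_rows d S \<longleftrightarrow> distinct S \<and> list_all (\<lambda>e. weight e = 4) S \<and>
     list_all (\<lambda>e. list_all (\<lambda>f. \<not> one_common e f) S) S \<and>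
     list_all (\<lambda>g. weight g = 4 \<longrightarrow> g \<in> set S \<or> list_ex (one_common g) S) (rows d 4)"

lemma saturated_rows_sound:
  assumes sat: "saturated_rows d (map (row d) es)" and sub: "\<forall>vs\<in>set es. set vs \<subseteq> {0..<d}"
  shows "bowtie_saturated {0..<d} (set ` set es)" and "card (set ` set es) = length es"
proof -
  let ?s = "select [0..<d]"
  have sel: "?s (row d vs) = set vs" if "vs \<in> set es" for vs
    using sub that by (auto simp: row_def select_map)
  have one: "one_common (row d vs) (row d ws) \<longleftrightarrow> card (set vs \<inter> set ws) = 1"
    if "vs \<in> set es" "ws \<in> set es" for vs ws
    using one_common_iff[of "[0..<d]"] sel that by (simp add: length_row)
  have card: "card (set vs) = 4" if "vs \<in> set es" for vs
    using sat that card_select[of "[0..<d]" "row d vs"] sel[OF that]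
    by (auto simp: saturated_rows_def list_all_iff length_row)
  have "\<exists>f\<in>set ` set es. card (g \<inter> f) = 1"
    if g: "g \<subseteq> {0..<d}" "card g = 4" "g \<notin> set ` set es" for g
  proof -
    let ?g = "map (\<lambda>x. x \<in> g) [0..<d]"
    have sg: "?s ?g = g" using g(1) by (auto simp: select_map)
    then have wg: "weight ?g = 4" using card_select[of "[0..<d]" ?g] g(2) by simp
    then have "?g \<in> set (rows d 4)" using rows_complete[of ?g 4] by simp
    then have "?g \<in> row d ` set es \<or> (\<exists>vs\<in>set es. one_common ?g (row d vs))"
      using sat wg by (auto simp: saturated_rows_def list_all_iff list_ex_iff)
    moreover have "?g \<notin> row d ` set es"
    proof
      assume "?g \<in> row d ` set es"
      then obtain vs where vs: "vs \<in> set es" "?g = row d vs" by blast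
      then have "set vs = g" using sel[OF vs(1)] sg by simp
      then show False using vs(1) g(3) by blast
    qed
    ultimately obtain vs where vs: "vs \<in> set es" "one_common ?g (row d vs)" by blast
    then have "card (g \<inter> set vs) = 1"
      using one_common_iff[of "[0..<d]" ?g "row d vs"] sg sel by (simp add: length_row)
    then show ?thesis using vs by blast
  qed
  then show "bowtie_saturated {0..<d} (set ` set es)"
    using sub card one sat
    by (auto simp: bowtie_saturated_def uniform4_def bowtie_free_def saturated_rows_def list_all_iff)
  have "distinct (map (row d) es)" using sat by (simp add: saturated_rows_def)
  then have "distinct es" "inj_on (row d) (set es)" by (auto simp: distinct_map)
  moreover have "row d vs = row d ws" if "set vs = set ws" for vs ws
    using that by (simp add: row_def)
  then have "inj_on set (set es)"
    using \<open>inj_on (row d) (set es)\<close> by (meson inj_on_def)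
  ultimately show "card (set ` set es) = length es"
    by (simp add: card_image distinct_card)
qed

text \<open>The complements of the seven lines of a Fano plane; any two of them share exactly two
  vertices.\<close>

definition seven_edges :: "nat list list" where
  "seven_edges = [[0, 1, 2, 3], [0, 1, 4, 5], [0, 2, 4, 6], [2, 3, 4, 5], [1, 3, 4, 6], [1, 2, 5, 6],
     [0, 3, 5, 6]]"

text \<open>Two disjoint edges, and the unions of \<open>{0, 1}\<close> with all six pairs in
  \<open>{4, 5, 6, 7}\<close>.\<close>

definition eight_edges :: "nat list list" where
  "eight_edges = [[0, 1, 2, 3], [4, 5, 6, 7], [0, 1, 4, 5], [0, 1, 4, 6], [0, 1, 4, 7], [0, 1, 5, 6],
     [0, 1, 5, 7], [0, 1, 6, 7]]"

text \<open>An isolated edge and all four-subsets of a five-element set.\<close>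

definition nine_edges :: "nat list list" where
  "nine_edges = [[0, 1, 2, 3], [4, 5, 6, 7], [4, 5, 6, 8], [4, 5, 7, 8], [4, 6, 7, 8], [5, 6, 7, 8]]"

text \<open>A disjoint union of an isolated edge and the seven-vertex family shifted to
  \<open>{4..10}\<close>.\<close>

definition eleven_edges :: "nat list list" where
  "eleven_edges = map (map ((+) 4)) seven_edges @ [[0, 1, 2, 3]]"

text \<open>For \<open>n = 10\<close> there are no edges \<open>{0, 1, 2, s}\<close>. For
  \<open>n = 11\<close> there is only one, and then no edge meets \<open>{0, 3, 4, 10}\<close>
  exactly once; this is why \<open>eleven_edges\<close> is a different family.\<close>

definition large_edges :: "nat \<Rightarrow> nat list list" where
  "large_edges n = [[0, 1, 3, 4], [0, 2, 3, 4], [1, 2, 3, 4], [3, 4, 5, 6], [5, 6, 7, 8], [5, 6, 7, 9],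
     [5, 6, 8, 9]] @ map (\<lambda>s. [0, 1, 2, s]) [10..<n]"

lemma saturated_rows_small:
  "saturated_rows 7 (map (row 7) seven_edges)"
  "saturated_rows 8 (map (row 8) eight_edges)"
  "saturated_rows 9 (map (row 9) nine_edges)"
  "saturated_rows 10 (map (row 10) (large_edges 10))"
  "saturated_rows 11 (map (row 11) eleven_edges)"
  "saturated_rows 12 (map (row 12) (large_edges 12))"
  "saturated_rows 13 (map (row 13) (large_edges 13))"
  by code_simp+

text \<open>In a new four-set \<open>insert v c\<close>, the vertex \<open>v\<close> can be replaced
  by a leaf \<open>s\<close> from \<open>L\<close> outside \<open>c\<close>, and saturation of the
  old family applies. Three leaves suffice: if \<open>c\<close> contains all of them, it equals
  \<open>L\<close> and is disjoint from \<open>t\<close>, so the new edge meets the four-set only in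
  \<open>v\<close>.\<close>

lemma add_leaf:
  assumes sat: "bowtie_saturated V E" and t: "t \<subseteq> V" "card t = 3" and v: "v \<notin> V"
    and L: "L \<subseteq> V - t" "card L = 3"
    and leaf: "\<And>s. s \<in> L \<Longrightarrow> insert s t \<in> E \<and> (\<forall>e\<in>E. s \<in> e \<longrightarrow> e = insert s t)"
  shows "bowtie_saturated (insert v V) (insert (insert v t) E)"
proof -
  have E: "\<And>e. e \<in> E \<Longrightarrow> e \<subseteq> V \<and> card e = 4"
    and free: "\<And>e f. e \<in> E \<Longrightarrow> f \<in> E \<Longrightarrow> card (e \<inter> f) \<noteq> 1"
    and hit: "\<And>g. g \<subseteq> V \<Longrightarrow> card g = 4 \<Longrightarrow> g \<notin> E \<Longrightarrow> \<exists>f\<in>E. card (g \<inter> f) = 1"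
    using sat by (auto simp: bowtie_saturated_def uniform4_def bowtie_free_def)
  have fin: "finite t" "finite L" using t(2) L(2) by (auto intro: card_ge_0_finite)
  have vt: "v \<notin> t" using v t by auto
  \<comment> \<open>A leaf \<open>s\<close> behaves like \<open>v\<close>: an edge without
    \<open>s\<close> meets \<open>t\<close> exactly as it meets the edge
    \<open>insert s t\<close>.\<close>
  have new: "card (insert v t \<inter> f) \<noteq> 1" if f: "f \<in> E" for f
  proof -
    obtain s where s: "s \<in> L" using L(2) by fastforce
    have "v \<notin> f" "s \<notin> t" using E[OF f] v s L by auto
    then have "insert v t \<inter> f = t \<inter> f" by auto
    moreover have "card (t \<inter> f) \<noteq> 1"
    proof (cases "s \<in> f")
      case True
      then have "t \<inter> f = t" using leaf[OF s] f by auto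
      then show ?thesis using t(2) by simp
    next
      case False
      then have "t \<inter> f = insert s t \<inter> f" by auto
      then show ?thesis using free leaf[OF s] f by metis
    qed
    ultimately show ?thesis by simp
  qed
  have "\<exists>f\<in>insert (insert v t) E. card (g \<inter> f) = 1"
    if g: "g \<subseteq> insert v V" "card g = 4" "g \<notin> insert (insert v t) E" for g
  proof (cases "v \<in> g")
    case False
    then show ?thesis using hit[of g] g by auto
  next
    case True
    define c where "c = g - {v}"
    have gfin: "finite g" using g(2) by (intro card_ge_0_finite) simp
    have c: "c \<subseteq> V" "card c = 3" "g = insert v c" "v \<notin> c" "finite c"
      using g True gfin by (auto simp: c_def)
    have disj: ?thesis if "c \<inter> t = {}"
    proof -
      have "g \<inter> insert v t = {v}" using c that vt by auto
      then show ?thesis by (intro bexI[of _ "insert v t"]) auto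
    qed
    show ?thesis
    proof (cases "L \<subseteq> c")
      case True
      then have "c = L" using card_subset_eq[OF c(5) True] c(2) L(2) by simp
      then show ?thesis using disj L(1) by blast
    next
      case False
      then obtain s where s: "s \<in> L" "s \<notin> c" by auto
      have sV: "s \<in> V" "s \<notin> t" using s L by auto
      have nE: "insert s c \<notin> E"
      proof
        assume "insert s c \<in> E"
        then have "insert s c = insert s t" using leaf[OF s(1)] by auto
        then have "c = t" using s(2) sV(2) by auto
        then show False using g(3) c(3) by simp
      qed
      have "card (insert s c) = 4" "insert s c \<subseteq> V" using s c sV by auto
      then obtain f where f: "f \<in> E" "card (insert s c \<inter> f) = 1"
        using hit nE by blast
      show ?thesis
      \<comment> \<open>If \<open>f\<close> contains \<open>s\<close>, it is the edge of the leaf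
        \<open>s\<close>, so \<open>c\<close> is disjoint from \<open>t\<close>. Otherwise
        \<open>f\<close> meets the new four-set just as it meets \<open>insert s c\<close>.\<close>
      proof (cases "s \<in> f")
        case True
        then have "f = insert s t" using leaf[OF s(1)] f(1) by blast
        moreover have "insert s c \<inter> f = {s}"
          using f(2) True by (auto simp: card_1_singleton_iff)
        ultimately show ?thesis using s(2) sV(2) by (intro disj) auto
      next
        case False
        then have "g \<inter> f = insert s c \<inter> f" using c E[OF f(1)] v by auto
        then show ?thesis using f by (intro bexI[of _ f]) simp_all
      qed
    qed
  qed
  moreover have "card (insert v t) = 4" "insert v t \<subseteq> insert v V" using t vt fin by auto
  moreover have "card (f \<inter> insert v t) \<noteq> 1" if "f \<in> E" for f
    using new[OF that] by (simp add: Int_commute)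
  moreover have "e \<subseteq> insert v V" if "e \<in> E" for e
    using E[OF that] by blast
  ultimately show ?thesis
    using E free new by (auto simp: bowtie_saturated_def uniform4_def bowtie_free_def)
qed

lemma large_edges_Suc: "10 \<le> n \<Longrightarrow> set ` set (large_edges (Suc n)) = insert {0, 1, 2, n} (set ` set (large_edges n))"
  by (auto simp: large_edges_def)

lemma large_edges_bound: "e \<in> set ` set (large_edges n) \<Longrightarrow> e \<subseteq> {0..<max 10 n}"
  by (auto simp: large_edges_def)

lemma large_edges_leaf:
  "s \<in> {10, 11, 12} \<Longrightarrow> e \<in> set ` set (large_edges n) \<Longrightarrow> s \<in> e \<Longrightarrow> e = {0, 1, 2, s}"
  by (auto simp: large_edges_def)

lemma bowtie_saturated_large:
  assumes "13 \<le> n"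
  shows "bowtie_saturated {0..<n} (set ` set (large_edges n)) \<and> card (set ` set (large_edges n)) = n - 3"
  using assms
proof (induction n rule: dec_induct)
  \<comment> \<open>Thirteen is the first size with the three leaves 10, 11, 12 demanded by
    \<open>add_leaf\<close>.\<close>
  case base
  have sub: "\<forall>vs\<in>set (large_edges 13). set vs \<subseteq> {0..<13}"
    by (auto simp: large_edges_def)
  have "length (large_edges 13) = 10" by (simp add: large_edges_def)
  then show ?case
    using saturated_rows_sound[OF saturated_rows_small(7) sub] by simp
next
  case (step n)
  let ?E = "set ` set (large_edges n)"
  have eq: "{0, 1, 2, n} = insert n {0, 1, 2}" by auto
  have "bowtie_saturated (insert n {0..<n}) (insert (insert n {0, 1, 2}) ?E)"
  proof (rule add_leaf[where L = "{10, 11, 12}"])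
    fix s :: nat assume s: "s \<in> {10, 11, 12}"
    then have "[0, 1, 2, s] \<in> set (large_edges n)"
      using step.hyps by (auto simp: large_edges_def)
    then have "{0, 1, 2, s} \<in> ?E" by (metis image_eqI list.set(1) list.set(2))
    moreover have "{0, 1, 2, s} = insert s {0, 1, 2}" by auto
    ultimately show "insert s {0, 1, 2} \<in> ?E \<and> (\<forall>e\<in>?E. s \<in> e \<longrightarrow> e = insert s {0, 1, 2})"
      using large_edges_leaf[OF s] by metis
  qed (use step in auto)
  moreover have "insert n {0..<n} = {0..<Suc n}" by auto
  moreover have E': "set ` set (large_edges (Suc n)) = insert (insert n {0, 1, 2}) ?E"
    using large_edges_Suc[of n] step.hyps unfolding eq by simp
  ultimately have "bowtie_saturated {0..<Suc n} (set ` set (large_edges (Suc n)))"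
    by simp
  moreover have "insert n {0, 1, 2} \<notin> ?E"
    using large_edges_bound[of "insert n {0, 1, 2}" n] step.hyps by auto
  then have "card (set ` set (large_edges (Suc n))) = Suc (card ?E)"
    unfolding E' by (intro card_insert_disjoint) simp
  moreover have "Suc (n - 3) = Suc n - 3" using step.hyps by simp
  ultimately show ?case using step.IH by simp
qed

lemma bowtie_saturated_ge_9:
  assumes "9 \<le> n"
  shows "\<exists>E. bowtie_saturated {0..<n} E \<and> card E = n - 3"
proof -
  consider "n = 9" | "n = 10" | "n = 11" | "n = 12" | "13 \<le> n" using assms by linarith
  then show ?thesis
  proof cases
    case 1
    have "\<forall>vs\<in>set nine_edges. set vs \<subseteq> {0..<9}" "length nine_edges = 6" by (auto simp: nine_edges_def)
    then show ?thesis using saturated_rows_sound[OF saturated_rows_small(3)] 1 by auto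
  next
    case 2
    have "\<forall>vs\<in>set (large_edges 10). set vs \<subseteq> {0..<10}" "length (large_edges 10) = 7" by (auto simp: large_edges_def)
    then show ?thesis using saturated_rows_sound[OF saturated_rows_small(4)] 2 by auto
  next
    case 3
    have "\<forall>vs\<in>set eleven_edges. set vs \<subseteq> {0..<11}" "length eleven_edges = 8"
      by (auto simp: eleven_edges_def seven_edges_def)
    then show ?thesis using saturated_rows_sound[OF saturated_rows_small(5)] 3 by auto
  next
    case 4
    have "\<forall>vs\<in>set (large_edges 12). set vs \<subseteq> {0..<12}" "length (large_edges 12) = 9" by (auto simp: large_edges_def)
    then show ?thesis using saturated_rows_sound[OF saturated_rows_small(6)] 4 by auto
  next
    case 5
    then show ?thesis using bowtie_saturated_large by blast
  qed
qed

section \<open>At most six vertices, and the saturation numbers\<close>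

lemma inter_ne_1_if_small:
  fixes e f :: "nat set"
  assumes "e \<subseteq> {0..<n}" "f \<subseteq> {0..<n}" "card e = 4" "card f = 4" "n \<le> 6"
  shows "card (e \<inter> f) \<noteq> 1"
proof -
  have "finite e" "finite f" using assms(1,2) finite_subset by blast+
  then have "card e + card f = card (e \<union> f) + card (e \<inter> f)" by (rule card_Un_Int)
  moreover have "card (e \<union> f) \<le> card {0..<n}" using assms(1,2) by (intro card_mono) auto
  ultimately show ?thesis using assms(3-5) by simp
qed

text \<open>Two four-sets within six vertices share at least two vertices, so no four-set can be
  kept out of a saturated family by a bow tie.\<close>

lemma bowtie_saturated_small_iff:
  fixes n :: nat
  assumes "n \<le> 6"
  shows "bowtie_saturated {0..<n} E \<longleftrightarrow> E = {e. e \<subseteq> {0..<n} \<and> card e = 4}"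
proof
  assume "bowtie_saturated {0..<n} E"
  then interpret saturated "{0..<n}" E by unfold_locales simp_all
  have "e \<in> E" if e: "e \<subseteq> {0..<n}" "card e = 4" for e
  proof (rule ccontr)
    assume "e \<notin> E"
    then obtain f where f: "f \<in> E" "card (e \<inter> f) = 1" using hit e by blast
    then show False
      using inter_ne_1_if_small[OF e(1) edge_subset[OF f(1)] e(2) card_edge[OF f(1)] assms] by simp
  qed
  then show "E = {e. e \<subseteq> {0..<n} \<and> card e = 4}"
    using edge_subset card_edge by blast
next
  assume "E = {e. e \<subseteq> {0..<n} \<and> card e = 4}"
  then show "bowtie_saturated {0..<n} E"
    using inter_ne_1_if_small[OF _ _ _ _ assms]
    by (simp add: bowtie_saturated_def uniform4_def bowtie_free_def)
qed

theorem theorem2p3: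
  fixes n :: nat
  assumes "n \<ge> 1"
  shows "sat4_B4 n = (if n \<le> 6 then n choose 4 else if n \<in> {7, 8} then n else n - 3)"
proof -
  have least: "sat4_B4 n = m"
    if ex: "\<exists>E. bowtie_saturated {0..<n} E \<and> card E = m"
      and bound: "\<And>E. saturated {0..<n} E \<Longrightarrow> m \<le> card E" for m
    unfolding sat4_B4_def
  proof (rule Least_equality)
    show "\<exists>E. bowtie_saturated {0..<n} E \<and> card E = m" by (fact ex)
    fix k assume "\<exists>E. bowtie_saturated {0..<n} E \<and> card E = k"
    then show "m \<le> k" using bound by (auto simp: saturated_def)
  qed
  consider "n \<le> 6" | "n = 7" | "n = 8" | "9 \<le> n" by linarith
  then show ?thesis
  proof cases
    case 1
    have "card {e. e \<subseteq> {0..<n} \<and> card e = 4} = n choose 4"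
      using n_subsets[of "{0..<n}" 4] by simp
    then have "sat4_B4 n = n choose 4"
      using bowtie_saturated_small_iff[OF 1] by (intro least) (auto simp: saturated_def)
    then show ?thesis using 1 by simp
  next
    case 2
    have sub: "\<forall>vs\<in>set seven_edges. set vs \<subseteq> {0..<7}" and len: "length seven_edges = 7"
      by (auto simp: seven_edges_def)
    have "sat4_B4 n = 7"
      using saturated_rows_sound[OF saturated_rows_small(1) sub] len 2
      by (intro least) (auto intro: saturated.card_edges_ge_7)
    then show ?thesis using 2 by simp
  next
    case 3
    have sub: "\<forall>vs\<in>set eight_edges. set vs \<subseteq> {0..<8}" and len: "length eight_edges = 8"
      by (auto simp: eight_edges_def)
    have "sat4_B4 n = 8"
      using saturated_rows_sound[OF saturated_rows_small(2) sub] len 3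
      by (intro least) (auto intro: saturated.card_edges_ge_8)
    then show ?thesis using 3 by simp
  next
    case 4
    have "n - 3 \<le> card E" if "saturated {0..<n} E" for E
      using saturated.card_vertices_le[OF that] by simp
    then have "sat4_B4 n = n - 3"
      using bowtie_saturated_ge_9[OF 4] by (intro least)
    then show ?thesis using 4 by simp
  qed
qed

end
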